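(* Assume, in addition to the standing assumptions listed in the context, that: (i) $P$ is a convex subset of a real vector space satisfying $\lambda p \in P$ for all $p \in P$, $\lambda \in (0,1]$; (ii) $U$ is a convex subset of $L^\infty_+(Y)$ for some complete measure space $(Y,\Xi,\eta)$, and $\lambda u \in U$ for all $u \in U$, $\lambda \in (0,1]$; (iii) $\lambda S(p,u) \leq S(\lambda p,\lambda u)$ for all $p \in P$, $u \in U$, $\lambda \in (0,1]$; $S(p,u_1) \leq S(p,u_2)$ for all $u_1,u_2 \in U$ with $u_1 \leq u_2$ and all $p \in P$; and $\lambda S(p_1,u_1) + (1-\lambda) S(p_2,u_2) \leq S(\lambda p_1 + (1-\lambda)p_2, \lambda u_1 + (1-\lambda)u_2)$ for all $p_1,p_2 \in P$, $u_1,u_2 \in U$, $\lambda \in [0,1]$; (iv) $\lambda \Phi(v) \leq \Phi(\lambda v)$ for all $v \in L^2_+(X)$, $\lambda \in (0,1]$, and $\lambda \Phi(v_1) + (1-\lambda)\Phi(v_2) \leq \Phi(\lambda v_1 + (1-\lambda)v_2)$ for all $v_1,v_2 \in L^2_+(X)$, $\lambda \in [0,1]$. Let $1 \leq r \leq 2 \leq s \leq \infty$ be such that $S(p,u) \in L^{[r,s]}(X)$ for all $p \in P$, $u \in U$. Then the maximal solution map $M$ of (F) is Hadamard directionally differentiable on $U \cap L^\infty_\oplus(Y)$ in the following sense: for every $u \in U \cap L^\infty_\oplus(Y)$ and every $h \in \mathbb{R}^+(U-u)$ there exists a unique $M'(u;h) \in L^{[r,s]}(X)$ such that, for all $\{\tau_n\}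 \subset (0,\infty)$ and $\{h_n\} \subset \mathbb{R}^+(U-u)$ satisfying $\tau_n \to 0$, $\|h-h_n\|_{L^\infty(Y)} \to 0$, and $u + \tau_n h_n \in U$ for all $n$, we have \[ \frac{M(u+\tau_n h_n) - M(u)}{\tau_n} \to M'(u;h) \quad \text{in } L^q(X) \text{ for all } q \in [r,s]\setminus\{\infty\}, \] and, in the case $s = \infty$, \[ \lim_{n\to\infty} \int_X z \left( \frac{M(u+\tau_n h_n) - M(u)}{\tau_n} - M'(u;h) \right) \mathrm{d}\mu = 0 \qquad \text{for all } z \in L^1(X). \]
   Context: Standing assumptions and notation. $(X,\Sigma,\mu)$ is a complete measure space. $L^q(X)$ are the usual Lebesgue spaces, ordered by $v_1 \leq v_2 :\iff v_1 \leq v_2$ $\mu$-a.e. in $X$; $L^q_+(X) := \{v \in L^q(X) \mid v \geq 0\}$; $L^{[r,s]}(X) := L^r(X) \cap L^s(X)$ for $1 \leq r \leq s \leq \infty$. The same conventions are used for $(Y,\Xi,\eta)$, and $L^\infty_\oplus(Y) := \{v \in L^\infty(Y) \mid v \geq c \text{ a.e. for a constant } c>0\}$. $\bar P$ is a set equipped with a partial order $\leq$, having at least two elements and a largest element $\bar p$; $P := \bar P \setminus \{\bar p\}$. $U$ is a nonempty set. $S\colon \bar P \times U \to L^2_+(X)$ satisfies $S(p_1,u) \leq S(p_2,u)$ for all $u \in U$ and $p_1,p_2 \in \bar P$ with $p_1 \leq p_2$. $\Phi\colon L^2(X) \to P$ satisfies $\Phi(v_1) \leq \Phi(v_2)$ for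 all $v_1,v_2 \in L^2(X)$ with $v_1 \leq v_2$. $\mathbb{R}^+(U-u) := \{\lambda (w-u) \mid \lambda > 0,\ w \in U\}$. For $u \in U$, problem (F) with parameter $u$ is: find $y \in L^2(X)$ with $y = S(\Phi(y),u)$. Under the standing assumptions, for every $u \in U$ the solution set of (F) is nonempty and possesses a unique largest element $M(u)$ (the maximal solution). *)

theory Defs
  imports "HOL-Analysis.Analysis" "HOL-Probability.Essential_Supremum"
begin

text \<open>
  Elements of Lebesgue spaces are represented by real-valued measurable functions;
  equality and order of classes become equality and order almost everywhere. A map
  defined on classes is a map on functions that respects equality almost everywhere, and
  a set of classes is a set of functions that is closed under it.
\<close>

definition Lp_norm :: "ennreal \<Rightarrow> 'a measure \<Rightarrow> ('a \<Rightarrow> real) \<Rightarrow> ennreal" where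
  "Lp_norm q M f =
    (if q = \<infinity> then esssup M (\<lambda>x. ennreal \<bar>f x\<bar>)
     else let I = (\<integral>\<^sup>+ x. ennreal (\<bar>f x\<bar> powr enn2real q) \<partial>M)
          in if I = \<infinity> then \<infinity> else ennreal (enn2real I powr (1 / enn2real q)))"

definition Lp :: "ennreal \<Rightarrow> 'a measure \<Rightarrow> ('a \<Rightarrow> real) set" where
  "Lp q M = {f \<in> borel_measurable M. Lp_norm q M f < \<infinity>}"

definition Lp_nonneg :: "ennreal \<Rightarrow> 'a measure \<Rightarrow> ('a \<Rightarrow> real) set" where
  "Lp_nonneg q M = {f \<in> Lp q M. AE x in M. 0 \<le> f x}"

definition Lp_between :: "ennreal \<Rightarrow> ennreal \<Rightarrow> 'a measure \<Rightarrow> ('a \<Rightarrow> real) set" where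
  "Lp_between r s M = Lp r M \<inter> Lp s M"

definition Linf_pos :: "'a measure \<Rightarrow> ('a \<Rightarrow> real) set" where
  "Linf_pos M = {f \<in> Lp \<infinity> M. \<exists>c>0. AE x in M. c \<le> f x}"

definition AE_closed :: "'a measure \<Rightarrow> ('a \<Rightarrow> real) set \<Rightarrow> bool" where
  "AE_closed M A \<longleftrightarrow>
    (\<forall>f\<in>A. \<forall>g\<in>borel_measurable M. (AE x in M. f x = g x) \<longrightarrow> g \<in> A)"

definition fun_convex :: "('a \<Rightarrow> real) set \<Rightarrow> bool" where
  "fun_convex A \<longleftrightarrow>
    (\<forall>f\<in>A. \<forall>g\<in>A. \<forall>t\<in>{0..1}. (\<lambda>x. t * f x + (1 - t) * g x) \<in> A)"

definition radial_cone :: "('a \<Rightarrow> real) set \<Rightarrow> ('a \<Rightarrow> real) \<Rightarrow> ('a \<Rightarrow> real) set" where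
  "radial_cone U u = {\<lambda>x. t * (w x - u x) | t w. t > 0 \<and> w \<in> U}"

text \<open>
  The standing assumptions. Well-definedness of \<open>Phi\<close> on classes needs no separate
  assumption: it follows from monotonicity and the antisymmetry of \<open>le\<close>.
\<close>

locale standing_assumptions = complete_measure X
  for X :: "'x measure" +
  fixes Pbar :: "'p set"
    and le :: "'p \<Rightarrow> 'p \<Rightarrow> bool"
    and pbar :: 'p
    and U :: "'u set"
    and S :: "'p \<Rightarrow> 'u \<Rightarrow> 'x \<Rightarrow> real"
    and Phi :: "('x \<Rightarrow> real) \<Rightarrow> 'p"
  assumes order: "reflp_on Pbar le" "transp_on Pbar le" "antisymp_on Pbar le"
    and two_elements: "\<exists>p\<in>Pbar. \<exists>q\<in>Pbar. p \<noteq> q"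
    and greatest: "pbar \<in> Pbar" "\<And>p. p \<in> Pbar \<Longrightarrow> le p pbar"
    and U_nonempty: "U \<noteq> {}"
    and S_range: "\<And>p u. p \<in> Pbar \<Longrightarrow> u \<in> U \<Longrightarrow> S p u \<in> Lp_nonneg 2 X"
    and S_mono: "\<And>p1 p2 u. p1 \<in> Pbar \<Longrightarrow> p2 \<in> Pbar \<Longrightarrow> u \<in> U \<Longrightarrow> le p1 p2 \<Longrightarrow>
      (AE x in X. S p1 u x \<le> S p2 u x)"
    and Phi_range: "\<And>v. v \<in> Lp 2 X \<Longrightarrow> Phi v \<in> Pbar - {pbar}"
    and Phi_mono: "\<And>v1 v2. v1 \<in> Lp 2 X \<Longrightarrow> v2 \<in> Lp 2 X \<Longrightarrow> (AE x in X. v1 x \<le> v2 x) \<Longrightarrow>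
      le (Phi v1) (Phi v2)"

definition is_solution ::
  "'x measure \<Rightarrow> ('p \<Rightarrow> 'u \<Rightarrow> 'x \<Rightarrow> real) \<Rightarrow> (('x \<Rightarrow> real) \<Rightarrow> 'p) \<Rightarrow> 'u \<Rightarrow> ('x \<Rightarrow> real) \<Rightarrow> bool" where
  "is_solution X S Phi u y \<longleftrightarrow> y \<in> Lp 2 X \<and> (AE x in X. y x = S (Phi y) u x)"

definition is_maximal_solution ::
  "'x measure \<Rightarrow> ('p \<Rightarrow> 'u \<Rightarrow> 'x \<Rightarrow> real) \<Rightarrow> (('x \<Rightarrow> real) \<Rightarrow> 'p) \<Rightarrow> 'u \<Rightarrow> ('x \<Rightarrow> real) \<Rightarrow> bool" where
  "is_maximal_solution X S Phi u y \<longleftrightarrow>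
    is_solution X S Phi u y \<and>
    (\<forall>w. is_solution X S Phi u w \<longrightarrow> (AE x in X. w x \<le> y x))"

text \<open>
  The maximal solution is unique as a class, so this picks one of its representatives.
\<close>

definition maximal_solution ::
  "'x measure \<Rightarrow> ('p \<Rightarrow> 'u \<Rightarrow> 'x \<Rightarrow> real) \<Rightarrow> (('x \<Rightarrow> real) \<Rightarrow> 'p) \<Rightarrow> 'u \<Rightarrow> 'x \<Rightarrow> real" where
  "maximal_solution X S Phi u = (SOME y. is_maximal_solution X S Phi u y)"

definition is_Hadamard_derivative ::
  "'x measure \<Rightarrow> 'y measure \<Rightarrow> ennreal \<Rightarrow> ennreal \<Rightarrow> ('y \<Rightarrow> real) set \<Rightarrow>
   (('y \<Rightarrow> real) \<Rightarrow> 'x \<Rightarrow> real) \<Rightarrow> ('y \<Rightarrow> real) \<Rightarrow> ('y \<Rightarrow> real) \<Rightarrow> ('x \<Rightarrow> real) \<Rightarrow> bool" where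
  "is_Hadamard_derivative X Y r s U F u h d \<longleftrightarrow>
    (\<forall>\<tau> hs.
      (\<forall>n. 0 < \<tau> n) \<longrightarrow>
      (\<forall>n. hs n \<in> radial_cone U u) \<longrightarrow>
      \<tau> \<longlonglongrightarrow> 0 \<longrightarrow>
      (\<lambda>n. Lp_norm \<infinity> Y (\<lambda>y. h y - hs n y)) \<longlonglongrightarrow> 0 \<longrightarrow>
      (\<forall>n. (\<lambda>y. u y + \<tau> n * hs n y) \<in> U) \<longrightarrow>
      (let R = \<lambda>n x. (F (\<lambda>y. u y + \<tau> n * hs n y) x - F u x) / \<tau> n - d x in
        (\<forall>q. r \<le> q \<longrightarrow> q \<le> s \<longrightarrow> q \<noteq> \<infinity> \<longrightarrow> (\<lambda>n. Lp_norm q X (R n)) \<longlonglongrightarrow> 0) \<and>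
        (s = \<infinity> \<longrightarrow> (\<forall>z\<in>Lp 1 X. (\<lambda>n. \<integral>x. z x * R n x \<partial>X) \<longlonglongrightarrow> 0))))"

end

theory Submission
  imports Defs
begin

text \<open>
  The proof separates the fixed-point problem from the differentiability question.

  The maximal solution \<open>M u\<close> is the largest subsolution, that is, the largest \<open>y\<close> in \<open>L\<^sup>2\<close>
  with \<open>y \<le> S (Phi y) u\<close> (\<open>maximal_solution_largest_subsolution\<close>). Under the monotonicity,
  superhomogeneity and concavity assumptions on \<open>S\<close> and \<open>\<Phi>\<close>, the function \<open>M u1\<close> is a
  subsolution for every \<open>u2 \<ge> u1\<close>, \<open>t * M u\<close> is one for \<open>t * u\<close>, and a convex combination of
  \<open>M u1\<close> and \<open>M u2\<close> is one for the same combination of \<open>u1\<close> and \<open>u2\<close>. Hence \<open>M\<close> is itself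
  monotone, superhomogeneous and concave.

  Any map \<open>F\<close> with these three properties and with values in \<open>L\<^sup>r \<inter> L\<^sup>s\<close> is Hadamard
  directionally differentiable at points \<open>u\<close> bounded below by a constant \<open>c > 0\<close>
  (\<open>Hadamard_differentiable\<close>). Concavity makes the difference quotients in a direction \<open>h\<close>
  increase as the step decreases (\<open>diff_quotient_antimono\<close>), so they converge almost
  everywhere as soon as they are bounded. Boundedness and stability under changes of the
  direction both follow from one observation: a perturbation of size \<open>e\<close> is at most \<open>(e / c)
  u\<close>, hence it only multiplies the argument by a factor close to one, and \<open>v \<le> a w\<close> with \<open>a \<ge>
  1\<close> implies \<open>F v \<le> a F w\<close> (\<open>F_le_multiple\<close>). Up to an error \<open>(e / c) \<bar>F u\<bar>\<close>, the quotients
  in the perturbed direction are thereby enclosed between quotients in the direction \<open>h\<close> at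
  slightly changed steps (\<open>diff_quotient_upper\<close>, \<open>diff_quotient_lower\<close>). All remainders have
  a common majorant in \<open>L\<^sup>r \<inter> L\<^sup>s\<close>, and dominated convergence yields the limits in every
  \<open>L\<^sup>q\<close> and, for \<open>s = \<infinity>\<close>, the weak-star limit.
\<close>

section \<open>Lebesgue spaces of real functions\<close>

lemma AE_abs_le_esssup:
  "AE x in N. ennreal \<bar>f x\<bar> \<le> Lp_norm \<infinity> N f"
  unfolding Lp_norm_def using esssup_AE[of "\<lambda>x. ennreal \<bar>f x\<bar>" N] by simp

lemma Lp_infinity_iff:
  "f \<in> Lp \<infinity> N \<longleftrightarrow> f \<in> borel_measurable N \<and> (\<exists>C\<ge>0. AE x in N. \<bar>f x\<bar> \<le> C)"
proof (intro iffI conjI; (elim conjE)?)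
  assume f: "f \<in> Lp \<infinity> N"
  then show "f \<in> borel_measurable N"
    by (simp add: Lp_def)
  obtain C where "Lp_norm \<infinity> N f = ennreal C" "C \<ge> 0"
    using f by (cases "Lp_norm \<infinity> N f") (auto simp: Lp_def)
  then show "\<exists>C\<ge>0. AE x in N. \<bar>f x\<bar> \<le> C"
    using AE_abs_le_esssup[of f N] by (auto intro!: exI[of _ C])
next
  assume [measurable]: "f \<in> borel_measurable N" and "\<exists>C\<ge>0. AE x in N. \<bar>f x\<bar> \<le> C"
  then obtain C where C: "C \<ge> 0" "AE x in N. \<bar>f x\<bar> \<le> C"
    by blast
  have "esssup N (\<lambda>x. ennreal \<bar>f x\<bar>) \<le> ennreal C"
    using C by (intro esssup_I) (auto intro: ennreal_leI)
  also have "\<dots> < \<infinity>"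
    by simp
  finally show "f \<in> Lp \<infinity> N"
    by (simp add: Lp_def Lp_norm_def)
qed

lemma Lp_finite_iff:
  assumes "q \<noteq> \<infinity>"
  shows "f \<in> Lp q N \<longleftrightarrow>
    f \<in> borel_measurable N \<and> (\<integral>\<^sup>+ x. ennreal (\<bar>f x\<bar> powr enn2real q) \<partial>N) < \<infinity>"
  using assms by (auto simp: Lp_def Lp_norm_def Let_def less_top)

lemma Lp_measurable: "f \<in> Lp q N \<Longrightarrow> f \<in> borel_measurable N"
  by (simp add: Lp_def)

text \<open>
  The single closure property of \<open>Lp\<close> from which sums, multiples, maxima and
  almost-everywhere modifications are obtained. For finite exponents it rests on \<open>(a + b)\<^sup>q \<le>
  2\<^sup>q (a\<^sup>q + b\<^sup>q)\<close>.
\<close>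

lemma Lp_dominated:
  assumes f: "f \<in> Lp q N" and g: "g \<in> Lp q N"
    and [measurable]: "k \<in> borel_measurable N"
    and C: "C \<ge> 0" and le: "AE x in N. \<bar>k x\<bar> \<le> C * (\<bar>f x\<bar> + \<bar>g x\<bar>)"
  shows "k \<in> Lp q N"
proof (cases "q = \<infinity>")
  case True
  obtain A B where "A \<ge> 0" "AE x in N. \<bar>f x\<bar> \<le> A" "B \<ge> 0" "AE x in N. \<bar>g x\<bar> \<le> B"
    using f g unfolding True Lp_infinity_iff by blast
  moreover have "AE x in N. \<bar>k x\<bar> \<le> C * (A + B)"
    using le calculation(2,4)
  proof eventually_elim
    case (elim x)
    then have "C * (\<bar>f x\<bar> + \<bar>g x\<bar>) \<le> C * (A + B)"
      by (intro mult_left_mono C) auto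
    with elim show ?case
      by linarith
  qed
  ultimately show ?thesis
    unfolding True Lp_infinity_iff using C by (auto intro!: exI[of _ "C * (A + B)"])
next
  case False
  define e where "e = enn2real q"
  have e: "e \<ge> 0"
    by (simp add: e_def)
  have [measurable]: "f \<in> borel_measurable N" "g \<in> borel_measurable N"
    using f g by (auto intro: Lp_measurable)
  have fin: "(\<integral>\<^sup>+ x. ennreal (\<bar>f x\<bar> powr e) \<partial>N) < \<infinity>"
      "(\<integral>\<^sup>+ x. ennreal (\<bar>g x\<bar> powr e) \<partial>N) < \<infinity>"
    using f g False by (simp_all add: Lp_finite_iff e_def)
  have "AE x in N. ennreal (\<bar>k x\<bar> powr e) \<le>
      ennreal ((2 * C) powr e) * (ennreal (\<bar>f x\<bar> powr e) + ennreal (\<bar>g x\<bar> powr e))"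
    using le
  proof eventually_elim
    case (elim x)
    have "\<bar>k x\<bar> \<le> 2 * C * max \<bar>f x\<bar> \<bar>g x\<bar>"
    proof -
      have "C * (\<bar>f x\<bar> + \<bar>g x\<bar>) \<le> C * (2 * max \<bar>f x\<bar> \<bar>g x\<bar>)"
        by (intro mult_left_mono C) auto
      with elim show ?thesis
        by (simp add: algebra_simps)
    qed
    then have "\<bar>k x\<bar> powr e \<le> (2 * C * max \<bar>f x\<bar> \<bar>g x\<bar>) powr e"
      by (intro powr_mono2) (use e in auto)
    also have "\<dots> = (2 * C) powr e * max \<bar>f x\<bar> \<bar>g x\<bar> powr e"
      using C by (simp add: powr_mult)
    also have "\<dots> \<le> (2 * C) powr e * (\<bar>f x\<bar> powr e + \<bar>g x\<bar> powr e)"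
      by (intro mult_left_mono) (auto simp: max_def)
    finally show ?case
      by (simp flip: ennreal_plus ennreal_mult)
  qed
  then have "(\<integral>\<^sup>+ x. ennreal (\<bar>k x\<bar> powr e) \<partial>N) \<le>
      (\<integral>\<^sup>+ x. ennreal ((2 * C) powr e) * (ennreal (\<bar>f x\<bar> powr e) + ennreal (\<bar>g x\<bar> powr e)) \<partial>N)"
    by (rule nn_integral_mono_AE)
  also have "\<dots> = ennreal ((2 * C) powr e) *
      ((\<integral>\<^sup>+ x. ennreal (\<bar>f x\<bar> powr e) \<partial>N) + (\<integral>\<^sup>+ x. ennreal (\<bar>g x\<bar> powr e) \<partial>N))"
    by (simp add: nn_integral_cmult nn_integral_add)
  also have "\<dots> < \<infinity>"
    using fin by (simp add: ennreal_mult_less_top)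
  finally show ?thesis
    using False by (simp add: Lp_finite_iff e_def)
qed

lemma Lp_cong_AE:
  assumes "f \<in> Lp q N" "g \<in> borel_measurable N" "AE x in N. f x = g x"
  shows "g \<in> Lp q N"
  by (rule Lp_dominated[OF assms(1,1,2), of 1]) (use assms(3) in auto)

lemma Lp_linear_combination:
  assumes "f \<in> Lp q N" "g \<in> Lp q N"
  shows "(\<lambda>x. a * f x + b * g x) \<in> Lp q N"
proof -
  have [measurable]: "f \<in> borel_measurable N" "g \<in> borel_measurable N"
    using assms by (auto intro: Lp_measurable)
  have "\<bar>a * f x + b * g x\<bar> \<le> (\<bar>a\<bar> + \<bar>b\<bar>) * (\<bar>f x\<bar> + \<bar>g x\<bar>)" for x
  proof -
    have "\<bar>a * f x + b * g x\<bar> \<le> \<bar>a\<bar> * \<bar>f x\<bar> + \<bar>b\<bar> * \<bar>g x\<bar>"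
      by (metis abs_mult abs_triangle_ineq)
    also have "\<dots> \<le> (\<bar>a\<bar> + \<bar>b\<bar>) * (\<bar>f x\<bar> + \<bar>g x\<bar>)"
      by (simp add: algebra_simps)
    finally show ?thesis .
  qed
  then show ?thesis
    by (intro Lp_dominated[OF assms, of _ "\<bar>a\<bar> + \<bar>b\<bar>"]) auto
qed

text \<open>
  For finite \<open>s\<close> this is \<open>a\<^sup>q \<le> a\<^sup>r + a\<^sup>s\<close>; for \<open>s = \<infinity>\<close> it is \<open>a\<^sup>q \<le> C powr (q - r) * a\<^sup>r\<close>
  with \<open>C\<close> an essential bound. No constants are tracked, because only membership is needed:
  convergence in all intermediate spaces will come from a single majorant.
\<close>

lemma Lp_interpolation:
  assumes f: "f \<in> Lp r N" "f \<in> Lp s N" and rq: "r \<le> q" and qs: "q \<le> s" and q: "q \<noteq> \<infinity>"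
  shows "f \<in> Lp q N"
proof -
  have [measurable]: "f \<in> borel_measurable N"
    using f by (auto intro: Lp_measurable)
  have r: "r \<noteq> \<infinity>"
    using rq q by (auto simp: top_unique)
  have fr: "(\<integral>\<^sup>+ x. ennreal (\<bar>f x\<bar> powr enn2real r) \<partial>N) < \<infinity>"
    using f r by (simp add: Lp_finite_iff)
  have rq': "enn2real r \<le> enn2real q"
    using rq q by (simp add: enn2real_mono less_top)
  have "(\<integral>\<^sup>+ x. ennreal (\<bar>f x\<bar> powr enn2real q) \<partial>N) < \<infinity>"
  proof (cases "s = \<infinity>")
    case True
    obtain C where C: "C \<ge> 0" "AE x in N. \<bar>f x\<bar> \<le> C"
      using f unfolding True Lp_infinity_iff by blast
    define D where "D = C powr (enn2real q - enn2real r)"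
    have "AE x in N. ennreal (\<bar>f x\<bar> powr enn2real q) \<le>
        ennreal D * ennreal (\<bar>f x\<bar> powr enn2real r)"
      using C(2)
    proof eventually_elim
      case (elim x)
      have "\<bar>f x\<bar> powr enn2real q = \<bar>f x\<bar> powr (enn2real q - enn2real r) * \<bar>f x\<bar> powr enn2real r"
        by (simp flip: powr_add)
      also have "\<dots> \<le> D * \<bar>f x\<bar> powr enn2real r"
        unfolding D_def using elim rq' by (intro mult_right_mono powr_mono2) auto
      finally show ?case
        by (simp add: D_def flip: ennreal_mult)
    qed
    then have "(\<integral>\<^sup>+ x. ennreal (\<bar>f x\<bar> powr enn2real q) \<partial>N) \<le>
        (\<integral>\<^sup>+ x. ennreal D * ennreal (\<bar>f x\<bar> powr enn2real r) \<partial>N)"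
      by (rule nn_integral_mono_AE)
    also have "\<dots> < \<infinity>"
      using fr by (simp add: nn_integral_cmult ennreal_mult_less_top)
    finally show ?thesis .
  next
    case False
    have fs: "(\<integral>\<^sup>+ x. ennreal (\<bar>f x\<bar> powr enn2real s) \<partial>N) < \<infinity>"
      using f False by (simp add: Lp_finite_iff)
    have qs': "enn2real q \<le> enn2real s"
      using qs False by (simp add: enn2real_mono less_top)
    have "a powr enn2real q \<le> a powr enn2real r + a powr enn2real s" if "a \<ge> 0" for a :: real
    proof (cases "a \<le> 1")
      case True
      then have "a powr enn2real q \<le> a powr enn2real r"
        using that rq' by (cases "a = 0") (auto intro: powr_mono')
      then show ?thesis
        by (simp add: add_increasing2)
    next
      case False
      then have "a powr enn2real q \<le> a powr enn2real s"
        using qs' by (auto intro: powr_mono)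
      then show ?thesis
        by (simp add: add_increasing)
    qed
    then have "(\<integral>\<^sup>+ x. ennreal (\<bar>f x\<bar> powr enn2real q) \<partial>N) \<le>
        (\<integral>\<^sup>+ x. ennreal (\<bar>f x\<bar> powr enn2real r) + ennreal (\<bar>f x\<bar> powr enn2real s) \<partial>N)"
      by (intro nn_integral_mono) (simp flip: ennreal_plus)
    also have "\<dots> < \<infinity>"
      using fr fs by (simp add: nn_integral_add)
    finally show ?thesis .
  qed
  then show ?thesis
    using q by (simp add: Lp_finite_iff)
qed

lemma Lp_norm_dominated_convergence:
  assumes q: "0 < q" "q \<noteq> \<infinity>" and G: "G \<in> Lp q N"
    and [measurable]: "\<And>n. R n \<in> borel_measurable N"
    and lim: "AE x in N. (\<lambda>n. R n x) \<longlonglongrightarrow> 0"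
    and bound: "\<And>n. AE x in N. \<bar>R n x\<bar> \<le> \<bar>G x\<bar>"
  shows "(\<lambda>n. Lp_norm q N (R n)) \<longlonglongrightarrow> 0"
proof -
  define e where "e = enn2real q"
  have e: "e > 0"
    using q by (simp add: e_def enn2real_positive_iff less_top)
  have [measurable]: "G \<in> borel_measurable N"
    using G by (rule Lp_measurable)
  define I where "I n = (\<integral>\<^sup>+ x. ennreal (\<bar>R n x\<bar> powr e) \<partial>N)" for n
  have Gfin: "(\<integral>\<^sup>+ x. ennreal (\<bar>G x\<bar> powr e) \<partial>N) < \<infinity>"
    using G q by (simp add: Lp_finite_iff e_def)
  have le: "AE x in N. ennreal (\<bar>R n x\<bar> powr e) \<le> ennreal (\<bar>G x\<bar> powr e)" for n
    using bound[of n] by eventually_elim (use e in \<open>auto intro!: ennreal_leI powr_mono2\<close>)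
  have Ifin: "I n < \<infinity>" for n
    using nn_integral_mono_AE[OF le[of n]] Gfin unfolding I_def by (rule le_less_trans)
  have "I \<longlonglongrightarrow> (\<integral>\<^sup>+ x. 0 \<partial>N)"
    unfolding I_def
  proof (rule nn_integral_dominated_convergence[OF _ _ _ le Gfin])
    show "AE x in N. (\<lambda>n. ennreal (\<bar>R n x\<bar> powr e)) \<longlonglongrightarrow> 0"
      using lim
    proof eventually_elim
      case (elim x)
      have "(\<lambda>n. \<bar>R n x\<bar> powr e) \<longlonglongrightarrow> 0 powr e"
        using e tendsto_rabs[OF elim] by (intro tendsto_powr2) auto
      then show ?case
        using e tendsto_ennrealI by fastforce
    qed
  qed auto
  then have "(\<lambda>n. enn2real (I n)) \<longlonglongrightarrow> 0"
    using tendsto_enn2real[of I 0 sequentially] by simp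
  then have "(\<lambda>n. enn2real (I n) powr (1 / e)) \<longlonglongrightarrow> 0 powr (1 / e)"
    using e by (intro tendsto_powr2) auto
  then have "(\<lambda>n. ennreal (enn2real (I n) powr (1 / e))) \<longlonglongrightarrow> 0"
    using tendsto_ennrealI by fastforce
  moreover have "Lp_norm q N (R n) = ennreal (enn2real (I n) powr (1 / e))" for n
    using q Ifin[of n] by (simp add: Lp_norm_def Let_def I_def e_def less_top)
  ultimately show ?thesis
    by simp
qed

lemma Lp_1_iff_integrable: "f \<in> Lp 1 N \<longleftrightarrow> integrable N f"
proof -
  have "\<bar>t\<bar> powr 1 = norm t" for t :: real
    by simp
  then show ?thesis
    by (simp add: Lp_finite_iff integrable_iff_bounded)
qed

text \<open>
  The substitute for norm convergence at the exponent \<open>\<infinity>\<close>: a majorant in \<open>L\<^sup>\<infinity>\<close> turns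
  convergence almost everywhere into weak-star convergence only.
\<close>

lemma integral_Linf_dominated_convergence:
  fixes R :: "nat \<Rightarrow> 'a \<Rightarrow> real"
  assumes z: "z \<in> Lp 1 N" and G: "G \<in> Lp \<infinity> N"
    and [measurable]: "\<And>n. R n \<in> borel_measurable N"
    and lim: "AE x in N. (\<lambda>n. R n x) \<longlonglongrightarrow> 0"
    and bound: "\<And>n. AE x in N. \<bar>R n x\<bar> \<le> \<bar>G x\<bar>"
  shows "(\<lambda>n. \<integral>x. z x * R n x \<partial>N) \<longlonglongrightarrow> 0"
proof -
  obtain C where C: "C \<ge> 0" "AE x in N. \<bar>G x\<bar> \<le> C"
    using G unfolding Lp_infinity_iff by blast
  have z': "integrable N z"
    using z by (simp add: Lp_1_iff_integrable)
  have [measurable]: "z \<in> borel_measurable N"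
    using z by (rule Lp_measurable)
  have "(\<lambda>n. \<integral>x. z x * R n x \<partial>N) \<longlonglongrightarrow> (\<integral>x. 0 \<partial>N)"
  proof (rule integral_dominated_convergence[where w = "\<lambda>x. C * \<bar>z x\<bar>"])
    show "AE x in N. (\<lambda>n. z x * R n x) \<longlonglongrightarrow> 0"
      using lim by eventually_elim (auto intro: tendsto_mult_right_zero)
    show "AE x in N. norm (z x * R n x) \<le> C * \<bar>z x\<bar>" for n
      using bound[of n] C(2)
      by eventually_elim (auto simp: abs_mult mult.commute[of C] intro!: mult_left_mono)
  qed (use z' in auto)
  then show ?thesis
    by simp
qed

text \<open>
  This will give uniqueness of derivatives. The inequality \<open>(a - b)\<^sup>2 \<le> 2 a\<^sup>2 + 2 b\<^sup>2\<close> does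
  the work of the triangle inequality for the norm.
\<close>

lemma Lp_2_limit_unique:
  assumes [measurable]: "f \<in> borel_measurable N" "g \<in> borel_measurable N"
      "\<And>n. v n \<in> borel_measurable N"
    and f: "(\<lambda>n. Lp_norm 2 N (\<lambda>x. v n x - f x)) \<longlonglongrightarrow> 0"
    and g: "(\<lambda>n. Lp_norm 2 N (\<lambda>x. v n x - g x)) \<longlonglongrightarrow> 0"
  shows "AE x in N. f x = g x"
proof -
  have lim: "(\<lambda>n. \<integral>\<^sup>+ x. ennreal (\<bar>v n x - k x\<bar> powr 2) \<partial>N) \<longlonglongrightarrow> 0"
    if k: "(\<lambda>n. Lp_norm 2 N (\<lambda>x. v n x - k x)) \<longlonglongrightarrow> 0" for k
  proof -
    have "(\<integral>\<^sup>+ x. ennreal (\<bar>v n x - k x\<bar> powr 2) \<partial>N) = Lp_norm 2 N (\<lambda>x. v n x - k x) ^ 2" for n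
    proof -
      define J where "J = (\<integral>\<^sup>+ x. ennreal (\<bar>v n x - k x\<bar> powr 2) \<partial>N)"
      have "Lp_norm 2 N (\<lambda>x. v n x - k x) =
          (if J = \<infinity> then \<infinity> else ennreal (enn2real J powr (1 / 2)))"
        unfolding J_def by (simp add: Lp_norm_def Let_def cong: if_cong)
      then have "J = Lp_norm 2 N (\<lambda>x. v n x - k x) ^ 2"
        by (cases J) (auto simp: powr_half_sqrt power2_eq_square simp flip: ennreal_mult)
      then show ?thesis
        by (simp only: J_def)
    qed
    moreover have "(\<lambda>n. Lp_norm 2 N (\<lambda>x. v n x - k x) ^ 2) \<longlonglongrightarrow> 0"
    proof (rule tendsto_sandwich[OF _ _ tendsto_const k])
      have "\<forall>\<^sub>F n in sequentially. Lp_norm 2 N (\<lambda>x. v n x - k x) < 1"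
        using order_tendstoD(2)[OF k, of 1] by simp
      then show "\<forall>\<^sub>F n in sequentially.
          Lp_norm 2 N (\<lambda>x. v n x - k x) ^ 2 \<le> Lp_norm 2 N (\<lambda>x. v n x - k x)"
      proof eventually_elim
        case (elim n)
        then show ?case
          using mult_left_mono[of "Lp_norm 2 N (\<lambda>x. v n x - k x)" 1] 
          by (simp add: power2_eq_square less_imp_le)
      qed
    qed simp
    ultimately show ?thesis
      by simp
  qed
  define D where "D = (\<integral>\<^sup>+ x. ennreal (\<bar>f x - g x\<bar> powr 2) \<partial>N)"
  have "D \<le> 2 * ((\<integral>\<^sup>+ x. ennreal (\<bar>v n x - f x\<bar> powr 2) \<partial>N) +
      (\<integral>\<^sup>+ x. ennreal (\<bar>v n x - g x\<bar> powr 2) \<partial>N))" for n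
  proof -
    have "\<bar>f x - g x\<bar> powr 2 \<le> 2 * (\<bar>v n x - f x\<bar> powr 2 + \<bar>v n x - g x\<bar> powr 2)" for x
    proof -
      have "0 \<le> ((v n x - f x) + (v n x - g x))\<^sup>2"
        by simp
      then show ?thesis
        by (simp add: power2_eq_square algebra_simps)
    qed
    then have "D \<le>
        (\<integral>\<^sup>+ x. 2 * (ennreal (\<bar>v n x - f x\<bar> powr 2) + ennreal (\<bar>v n x - g x\<bar> powr 2)) \<partial>N)"
      unfolding D_def
      by (intro nn_integral_mono)
        (auto simp flip: ennreal_plus ennreal_mult ennreal_numeral intro!: ennreal_leI)
    then show ?thesis
      by (simp add: nn_integral_cmult nn_integral_add)
  qed
  moreover have "(\<lambda>n. 2 * ((\<integral>\<^sup>+ x. ennreal (\<bar>v n x - f x\<bar> powr 2) \<partial>N) +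
      (\<integral>\<^sup>+ x. ennreal (\<bar>v n x - g x\<bar> powr 2) \<partial>N))) \<longlonglongrightarrow> 2 * (0 + 0)"
    by (intro ennreal_tendsto_cmult tendsto_add lim f g) simp
  ultimately have "D \<le> 0"
    by (intro LIMSEQ_le_const) auto
  then have "AE x in N. ennreal (\<bar>f x - g x\<bar> powr 2) = 0"
    unfolding D_def by (subst (asm) le_zero_eq, subst (asm) nn_integral_0_iff_AE) auto
  then show ?thesis
    by eventually_elim auto
qed

section \<open>Concave superhomogeneous monotone maps\<close>

text \<open>
  The properties of the maximal solution map that matter for differentiability. The
  fixed-point equation itself no longer appears.
\<close>

locale concave_superhomogeneous_map =
  fixes X :: "'x measure" and Y :: "'y measure" and r s :: ennreal
    and U :: "('y \<Rightarrow> real) set" and F :: "('y \<Rightarrow> real) \<Rightarrow> 'x \<Rightarrow> real"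
  assumes U_bounded: "U \<subseteq> Lp \<infinity> Y"
    and U_convex: "fun_convex U"
    and U_scale: "\<And>u t. u \<in> U \<Longrightarrow> t \<in> {0<..1} \<Longrightarrow> (\<lambda>y. t * u y) \<in> U"
    and F_Lp: "\<And>u. u \<in> U \<Longrightarrow> F u \<in> Lp_between r s X"
    and F_mono: "\<And>u1 u2. u1 \<in> U \<Longrightarrow> u2 \<in> U \<Longrightarrow> (AE y in Y. u1 y \<le> u2 y) \<Longrightarrow>
      (AE x in X. F u1 x \<le> F u2 x)"
    and F_scale: "\<And>u t. u \<in> U \<Longrightarrow> t \<in> {0<..1} \<Longrightarrow>
      (AE x in X. t * F u x \<le> F (\<lambda>y. t * u y) x)"
    and F_concave: "\<And>u1 u2 t. u1 \<in> U \<Longrightarrow> u2 \<in> U \<Longrightarrow> t \<in> {0..1} \<Longrightarrow>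
      (AE x in X. t * F u1 x + (1 - t) * F u2 x \<le> F (\<lambda>y. t * u1 y + (1 - t) * u2 y) x)"
    and exponents: "1 \<le> r" "r \<le> 2" "2 \<le> s"
begin

definition diff_quotient :: "('y \<Rightarrow> real) \<Rightarrow> ('y \<Rightarrow> real) \<Rightarrow> real \<Rightarrow> 'x \<Rightarrow> real" where
  "diff_quotient u h t x = (F (\<lambda>y. u y + t * h y) x - F u x) / t"

lemma F_measurable: "u \<in> U \<Longrightarrow> F u \<in> borel_measurable X"
  using F_Lp Lp_measurable unfolding Lp_between_def by blast

lemma U_convexD:
  "u \<in> U \<Longrightarrow> w \<in> U \<Longrightarrow> t \<in> {0..1} \<Longrightarrow> (\<lambda>y. t * u y + (1 - t) * w y) \<in> U"
  using U_convex unfolding fun_convex_def by blast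

lemma segment_subset:
  assumes "u \<in> U" "(\<lambda>y. u y + t * h y) \<in> U" "0 \<le> a" "a \<le> t" "0 < t"
  shows "(\<lambda>y. u y + a * h y) \<in> U"
proof -
  have "(\<lambda>y. (a / t) * (u y + t * h y) + (1 - a / t) * u y) \<in> U"
    using assms by (intro U_convexD) auto
  moreover have "(\<lambda>y. (a / t) * (u y + t * h y) + (1 - a / t) * u y) = (\<lambda>y. u y + a * h y)"
    using assms by (auto simp: field_simps)
  ultimately show ?thesis
    by simp
qed

text \<open>
  The admissible directions are those along which some initial segment stays in \<open>U\<close>; together
  with \<open>segment_subset\<close> this makes difference quotients available for all small steps.
\<close>

lemma radial_cone_iff:
  assumes u: "u \<in> U"
  shows "h \<in> radial_cone U u \<longleftrightarrow> (\<exists>T>0. (\<lambda>y. u y + T * h y) \<in> U)"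
proof
  assume "h \<in> radial_cone U u"
  then obtain l w where h: "h = (\<lambda>y. l * (w y - u y))" and "l > 0" "w \<in> U"
    unfolding radial_cone_def by blast
  moreover have "(\<lambda>y. u y + (1 / l) * h y) = w"
    using \<open>l > 0\<close> by (auto simp: h)
  ultimately show "\<exists>T>0. (\<lambda>y. u y + T * h y) \<in> U"
    by (intro exI[of _ "1 / l"]) simp
next
  assume "\<exists>T>0. (\<lambda>y. u y + T * h y) \<in> U"
  then obtain T where "T > 0" "(\<lambda>y. u y + T * h y) \<in> U"
    by blast
  moreover from this have "h = (\<lambda>y. (1 / T) * ((u y + T * h y) - u y))"
    by auto
  ultimately show "h \<in> radial_cone U u"
    unfolding radial_cone_def
    by (intro CollectI exI[of _ "1 / T"] exI[of _ "\<lambda>y. u y + T * h y"]) auto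
qed

text \<open>
  Dividing by \<open>a\<close> stays inside \<open>U\<close> and costs nothing by superhomogeneity, so an order
  estimate between arguments transfers with the same factor. The comparison of difference
  quotients rests on this.
\<close>

lemma F_le_multiple:
  assumes v: "v \<in> U" and w: "w \<in> U" and a: "a \<ge> 1" and le: "AE y in Y. v y \<le> a * w y"
  shows "AE x in X. F v x \<le> a * F w x"
proof -
  have a': "1 / a \<in> {0<..1}"
    using a by simp
  have "AE y in Y. (1 / a) * v y \<le> w y"
    using le by eventually_elim (use a in \<open>simp add: field_simps\<close>)
  then have "AE x in X. F (\<lambda>y. (1 / a) * v y) x \<le> F w x"
    using U_scale[OF v a'] w by (intro F_mono)
  then show ?thesis
    using F_scale[OF v a']
  proof eventually_elim
    case (elim x)
    then have "(1 / a) * F v x \<le> F w x"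
      by linarith
    then show ?case
      using a by (simp add: pos_divide_le_eq mult.commute)
  qed
qed

text \<open>
  Concavity along the segment from \<open>u\<close> to \<open>u + t h\<close>: shrinking the step increases the
  quotient.
\<close>

lemma diff_quotient_antimono:
  assumes u: "u \<in> U" and uh: "(\<lambda>y. u y + t * h y) \<in> U" and a: "0 < a" "a \<le> t"
  shows "AE x in X. diff_quotient u h t x \<le> diff_quotient u h a x"
proof -
  have t: "t > 0"
    using a by simp
  have eq: "(\<lambda>y. (a / t) * (u y + t * h y) + (1 - a / t) * u y) = (\<lambda>y. u y + a * h y)"
    using t by (auto simp: field_simps)
  have "AE x in X. (a / t) * F (\<lambda>y. u y + t * h y) x + (1 - a / t) * F u x \<le>
      F (\<lambda>y. u y + a * h y) x"
    using F_concave[OF uh u, of "a / t"] a t unfolding eq by simp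
  then show ?thesis
  proof eventually_elim
    case (elim x)
    have "a * ((F (\<lambda>y. u y + t * h y) x - F u x) / t) =
        (a / t) * F (\<lambda>y. u y + t * h y) x + (1 - a / t) * F u x - F u x"
      using t by (simp add: field_simps)
    also have "\<dots> \<le> F (\<lambda>y. u y + a * h y) x - F u x"
      using elim by simp
    finally have "a * ((F (\<lambda>y. u y + t * h y) x - F u x) / t) \<le>
        F (\<lambda>y. u y + a * h y) x - F u x" .
    then show ?case
      unfolding diff_quotient_def using a by (simp add: pos_le_divide_eq mult.commute)
  qed
qed

text \<open>
  Comparison of two directions. As \<open>u \<ge> c\<close>, a perturbation of the direction by at most \<open>e\<close> is
  at most \<open>(e / c) u\<close>, and therefore \<open>u + t k \<le> a (u + (t / a) h)\<close> with \<open>a = 1 + t (e / c)\<close>: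
  the error has been absorbed into a multiple of a point on the ray in direction \<open>h\<close>. This is
  where positivity of \<open>u\<close> away from zero enters.
\<close>

lemma diff_quotient_upper:
  assumes u: "u \<in> U" and c: "c > 0" "AE y in Y. c \<le> u y"
    and t: "t > 0" and e: "e \<ge> 0" and k: "AE y in Y. k y \<le> h y + e"
    and uk: "(\<lambda>y. u y + t * k y) \<in> U"
    and uh: "(\<lambda>y. u y + (t / (1 + t * (e / c))) * h y) \<in> U"
  shows "AE x in X. diff_quotient u k t x \<le>
    diff_quotient u h (t / (1 + t * (e / c))) x + e / c * F u x"
proof -
  define a where "a = 1 + t * (e / c)"
  have a: "a \<ge> 1"
    using t e c by (simp add: a_def)
  have "AE y in Y. u y + t * k y \<le> a * (u y + (t / a) * h y)"
    using k c(2)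
  proof eventually_elim
    case (elim y)
    have "e \<le> e / c * u y"
      using mult_left_mono[OF elim(2), of "e / c"] c e by simp
    then have "k y \<le> h y + e / c * u y"
      using elim(1) by simp
    then have "t * k y \<le> t * (h y + e / c * u y)"
      using t by (intro mult_left_mono) auto
    moreover have "a * (u y + (t / a) * h y) = u y + t * (h y + e / c * u y)"
      using a by (simp add: distrib_left) (simp add: a_def algebra_simps)
    ultimately show ?case
      by simp
  qed
  then have "AE x in X. F (\<lambda>y. u y + t * k y) x \<le> a * F (\<lambda>y. u y + (t / a) * h y) x"
    by (intro F_le_multiple uk uh[folded a_def] a)
  then show ?thesis
    unfolding a_def[symmetric]
  proof eventually_elim
    case (elim x)
    have "diff_quotient u k t x \<le> (a * F (\<lambda>y. u y + (t / a) * h y) x - F u x) / t"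
      unfolding diff_quotient_def using elim t by (intro divide_right_mono) auto
    also have "\<dots> = diff_quotient u h (t / a) x + (a - 1) / t * F u x"
      unfolding diff_quotient_def using a t by (simp add: field_simps)
    also have "(a - 1) / t = e / c"
      using t by (simp add: a_def)
    finally show ?case .
  qed
qed

text \<open>
  The same absorption from below: \<open>u + t k \<ge> b (u + (t / b) h)\<close> with \<open>b = 1 - t (e / c)\<close>. The
  step on the ray is now slightly longer than \<open>t\<close>.
\<close>

lemma diff_quotient_lower:
  assumes u: "u \<in> U" and c: "c > 0" "AE y in Y. c \<le> u y"
    and t: "t > 0" and e: "e \<ge> 0" "t * (e / c) < 1" and k: "AE y in Y. h y - e \<le> k y"
    and uk: "(\<lambda>y. u y + t * k y) \<in> U"
    and uh: "(\<lambda>y. u y + (t / (1 - t * (e / c))) * h y) \<in> U"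
  shows "AE x in X. diff_quotient u h (t / (1 - t * (e / c))) x - e / c * F u x \<le>
    diff_quotient u k t x"
proof -
  define b where "b = 1 - t * (e / c)"
  have b: "0 < b" "b \<le> 1"
    using t e c by (simp_all add: b_def)
  have "AE y in Y. u y + (t / b) * h y \<le> (1 / b) * (u y + t * k y)"
    using k c(2)
  proof eventually_elim
    case (elim y)
    have "e \<le> e / c * u y"
      using mult_left_mono[OF elim(2), of "e / c"] c e by simp
    then have "h y - e / c * u y \<le> k y"
      using elim(1) by simp
    then have "t * (h y - e / c * u y) \<le> t * k y"
      using t by (intro mult_left_mono) auto
    moreover have "b * (u y + (t / b) * h y) = u y + t * (h y - e / c * u y)"
      using b by (simp add: distrib_left) (simp add: b_def algebra_simps)
    ultimately have "b * (u y + (t / b) * h y) \<le> u y + t * k y"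
      by simp
    then show ?case
      using b by (simp add: pos_le_divide_eq mult.commute)
  qed
  then have "AE x in X. F (\<lambda>y. u y + (t / b) * h y) x \<le> (1 / b) * F (\<lambda>y. u y + t * k y) x"
    using b by (intro F_le_multiple uk uh[folded b_def]) auto
  then show ?thesis
    unfolding b_def[symmetric]
  proof eventually_elim
    case (elim x)
    have *: "b * F (\<lambda>y. u y + (t / b) * h y) x \<le> F (\<lambda>y. u y + t * k y) x"
      using elim b by (simp add: pos_le_divide_eq mult.commute)
    have "diff_quotient u h (t / b) x - (1 - b) / t * F u x =
        (b * F (\<lambda>y. u y + (t / b) * h y) x - F u x) / t"
      unfolding diff_quotient_def using b t by (simp add: field_simps)
    also have "\<dots> \<le> diff_quotient u k t x"
      unfolding diff_quotient_def using * t by (intro divide_right_mono) auto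
    also have "(1 - b) / t = e / c"
      using t by (simp add: b_def)
    finally show ?case .
  qed
qed

lemma diff_quotient_Lp:
  assumes "u \<in> U" "(\<lambda>y. u y + t * h y) \<in> U" "q \<in> {r, s}"
  shows "diff_quotient u h t \<in> Lp q X"
proof -
  have "(\<lambda>x. (1 / t) * F (\<lambda>y. u y + t * h y) x + (- 1 / t) * F u x) \<in> Lp q X"
    using F_Lp[OF assms(1)] F_Lp[OF assms(2)] assms(3)
    by (intro Lp_linear_combination) (auto simp: Lp_between_def)
  also have "(\<lambda>x. (1 / t) * F (\<lambda>y. u y + t * h y) x + (- 1 / t) * F u x) = diff_quotient u h t"
    by (auto simp: diff_quotient_def fun_eq_iff diff_divide_distrib)
  finally show ?thesis .
qed

text \<open>
  The direction \<open>h\<close> is a bounded perturbation of the direction zero, whose difference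
  quotients vanish, so that \<open>diff_quotient_upper\<close> bounds all quotients by a multiple of \<open>F
  u\<close>.
\<close>

lemma diff_quotient_bounded_above:
  assumes u: "u \<in> U" and c: "c > 0" "AE y in Y. c \<le> u y"
    and T: "T > 0" "(\<lambda>y. u y + T * h y) \<in> U"
  obtains K where "\<And>t. 0 < t \<Longrightarrow> t \<le> T \<Longrightarrow> AE x in X. diff_quotient u h t x \<le> K * F u x"
proof -
  have "(\<lambda>y. (1 / T) * (u y + T * h y) + (- 1 / T) * u y) \<in> Lp \<infinity> Y"
    using u T U_bounded by (intro Lp_linear_combination) auto
  also have "(\<lambda>y. (1 / T) * (u y + T * h y) + (- 1 / T) * u y) = h"
    using T by (auto simp: field_simps)
  finally obtain B where B: "B \<ge> 0" "AE y in Y. \<bar>h y\<bar> \<le> B"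
    unfolding Lp_infinity_iff by blast
  have "AE x in X. diff_quotient u h t x \<le> B / c * F u x" if "0 < t" "t \<le> T" for t
  proof -
    have "AE x in X. diff_quotient u h t x \<le>
        diff_quotient u (\<lambda>_. 0) (t / (1 + t * (B / c))) x + B / c * F u x"
      using segment_subset[OF u T(2), of t] that T u B
      by (intro diff_quotient_upper u c) auto
    then show ?thesis
      by (simp add: diff_quotient_def)
  qed
  then show ?thesis
    by (rule that)
qed

text \<open>
  Along a sequence of steps decreasing to zero the quotients increase and are bounded, hence
  converge almost everywhere; the limit lies between two functions of the required
  integrability and dominates every quotient.
\<close>

lemma diff_quotient_limit:
  assumes u: "u \<in> U" and c: "c > 0" "AE y in Y. c \<le> u y"
    and T: "T > 0" "(\<lambda>y. u y + T * h y) \<in> U"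
  shows "\<exists>d \<in> Lp_between r s X.
    (AE x in X. (\<lambda>k. diff_quotient u h (T / real (Suc k)) x) \<longlonglongrightarrow> d x) \<and>
    (\<forall>t. 0 < t \<longrightarrow> t \<le> T \<longrightarrow> (AE x in X. diff_quotient u h t x \<le> d x))"
proof -
  obtain K where K: "\<And>t. 0 < t \<Longrightarrow> t \<le> T \<Longrightarrow> AE x in X. diff_quotient u h t x \<le> K * F u x"
    using diff_quotient_bounded_above[OF u c T] by metis
  define Q where "Q k = diff_quotient u h (T / real (Suc k))" for k
  define d where "d x = lim (\<lambda>k. Q k x)" for x
  have seg: "(\<lambda>y. u y + t * h y) \<in> U" if "0 < t" "t \<le> T" for t
    using segment_subset[OF u T(2)] that T by auto
  have step: "0 < T / real (Suc k)" "T / real (Suc k) \<le> T" for k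
    using T by (auto simp: field_simps)
  have Q_meas [measurable]: "Q k \<in> borel_measurable X" for k
    unfolding Q_def using diff_quotient_Lp[OF u seg[OF step]] by (auto intro: Lp_measurable)
  have d_meas [measurable]: "d \<in> borel_measurable X"
    unfolding d_def by measurable
  have "AE x in X. \<forall>k. Q k x \<le> Q (Suc k) x"
    unfolding AE_all_countable Q_def
    using T by (intro allI diff_quotient_antimono u seg) (auto simp: field_simps)
  moreover have "AE x in X. \<forall>k. Q k x \<le> K * F u x"
    unfolding AE_all_countable Q_def by (intro allI K step)
  ultimately have ae: "AE x in X. (\<lambda>k. Q k x) \<longlonglongrightarrow> d x \<and> (\<forall>k. Q k x \<le> d x) \<and> d x \<le> K * F u x"
  proof eventually_elim
    case (elim x)
    have inc: "incseq (\<lambda>k. Q k x)"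
      using elim(1) by (intro incseq_SucI) auto
    obtain l where "(\<lambda>k. Q k x) \<longlonglongrightarrow> l" "\<forall>k. Q k x \<le> l"
      using incseq_convergent[OF inc elim(2)] .
    then have lim: "(\<lambda>k. Q k x) \<longlonglongrightarrow> d x"
      by (simp add: d_def limI)
    then show ?case
      using incseq_le[OF inc] elim(2) by (auto intro: LIMSEQ_le_const2)
  qed
  have "d \<in> Lp q X" if q: "q \<in> {r, s}" for q
  proof (rule Lp_dominated)
    show "diff_quotient u h T \<in> Lp q X"
      by (rule diff_quotient_Lp[OF u T(2) q])
    show "F u \<in> Lp q X"
      using F_Lp[OF u] q by (auto simp: Lp_between_def)
    show "AE x in X. \<bar>d x\<bar> \<le> (1 + \<bar>K\<bar>) * (\<bar>diff_quotient u h T x\<bar> + \<bar>F u x\<bar>)"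
      using ae
    proof eventually_elim
      case (elim x)
      have "Q 0 x \<le> d x"
        using elim by blast
      then have "diff_quotient u h T x \<le> d x"
        by (simp add: Q_def)
      moreover have "d x \<le> \<bar>K\<bar> * \<bar>F u x\<bar>"
        using elim by (metis abs_ge_self abs_mult order_trans)
      moreover have "\<bar>a\<bar> \<le> \<bar>b\<bar> + m" if "b \<le> a" "a \<le> m" "0 \<le> m" for a b m :: real
        using that by linarith
      ultimately have "\<bar>d x\<bar> \<le> \<bar>diff_quotient u h T x\<bar> + \<bar>K\<bar> * \<bar>F u x\<bar>"
        by simp
      also have "\<dots> \<le> (1 + \<bar>K\<bar>) * (\<bar>diff_quotient u h T x\<bar> + \<bar>F u x\<bar>)"
        by (simp add: algebra_simps)
      finally show ?case .
    qed
  qed auto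
  then have "d \<in> Lp_between r s X"
    by (simp add: Lp_between_def)
  moreover have "AE x in X. diff_quotient u h t x \<le> d x" if t: "0 < t" "t \<le> T" for t
  proof -
    have "(\<lambda>k. T / real (Suc k)) \<longlonglongrightarrow> 0"
      by (rule LIMSEQ_Suc[OF lim_const_over_n])
    then have "\<forall>\<^sub>F k in sequentially. T / real (Suc k) < t"
      using t by (simp add: order_tendsto_iff)
    then obtain k where "T / real (Suc k) < t"
      by (meson eventually_sequentially order_refl)
    then have "AE x in X. diff_quotient u h t x \<le> Q k x"
      unfolding Q_def by (intro diff_quotient_antimono u seg t step) auto
    then show ?thesis
      using ae by eventually_elim (meson order_trans)
  qed
  moreover have "AE x in X. (\<lambda>k. diff_quotient u h (T / real (Suc k)) x) \<longlonglongrightarrow> d x"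
    using ae unfolding Q_def by eventually_elim blast
  ultimately show ?thesis
    by blast
qed

text \<open>
  The derivative \<open>d\<close> is the limit of the quotients in the fixed direction \<open>h\<close>. For perturbed
  directions \<open>hs n\<close> at distance \<open>e n\<close> from \<open>h\<close>, the two comparison lemmas, together with \<open>Q \<le>
  d\<close> for the quotients \<open>Q\<close> in direction \<open>h\<close>, give \<open>\<bar>R n\<bar> \<le> (e n / c) \<bar>F u\<bar> + (d - Q (\<tau> n / b
  n))\<close>, where \<open>R n\<close> is the remainder. The right-hand side tends to zero almost everywhere and
  has a majorant in \<open>L\<^sup>r \<inter> L\<^sup>s\<close>, so that dominated convergence covers all exponents at once.
\<close>

theorem Hadamard_differentiable:
  assumes u: "u \<in> U" and c: "c > 0" "AE y in Y. c \<le> u y" and h: "h \<in> radial_cone U u"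
  shows "\<exists>d \<in> Lp_between r s X. is_Hadamard_derivative X Y r s U F u h d"
proof -
  obtain T where T: "T > 0" "(\<lambda>y. u y + T * h y) \<in> U"
    using h radial_cone_iff[OF u] by blast
  obtain d where d: "d \<in> Lp_between r s X"
      and d_lim: "AE x in X. (\<lambda>k. diff_quotient u h (T / real (Suc k)) x) \<longlonglongrightarrow> d x"
      and d_upper: "\<And>t. 0 < t \<Longrightarrow> t \<le> T \<Longrightarrow> AE x in X. diff_quotient u h t x \<le> d x"
    using diff_quotient_limit[OF u c T] by blast
  have seg: "(\<lambda>y. u y + t * h y) \<in> U" if "0 < t" "t \<le> T" for t
    using segment_subset[OF u T(2)] that T by auto
  have [measurable]: "d \<in> borel_measurable X" "F u \<in> borel_measurable X"
    using d F_measurable[OF u] by (auto simp: Lp_between_def intro: Lp_measurable)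
  \<comment> \<open>The majorant: \<open>d - Q\<close> is largest at the longest admissible step \<open>T\<close>, and \<open>e n / c < 1\<close>
    for large \<open>n\<close>.\<close>
  define G where "G x = \<bar>F u x\<bar> + (d x - diff_quotient u h T x)" for x
  have G: "G \<in> Lp q X" if q: "q \<in> {r, s}" for q
  proof -
    have *: "diff_quotient u h T \<in> Lp q X" "F u \<in> Lp q X" "d \<in> Lp q X"
      using diff_quotient_Lp[OF u T(2) q] F_Lp[OF u] d q by (auto simp: Lp_between_def)
    have [measurable]: "diff_quotient u h T \<in> borel_measurable X"
      using * by (auto intro: Lp_measurable)
    have "(\<lambda>x. 1 * d x + (- 1) * diff_quotient u h T x) \<in> Lp q X"
      by (intro Lp_linear_combination *)
    then show ?thesis
      unfolding G_def
      by (rule Lp_dominated[OF _ \<open>F u \<in> Lp q X\<close>, of _ _ 1]) auto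
  qed
  have "is_Hadamard_derivative X Y r s U F u h d"
    unfolding is_Hadamard_derivative_def
  proof (intro allI impI)
    fix \<tau> :: "nat \<Rightarrow> real" and hs :: "nat \<Rightarrow> 'y \<Rightarrow> real"
    assume \<tau>: "\<forall>n. 0 < \<tau> n" "\<tau> \<longlonglongrightarrow> 0"
      and hs: "(\<lambda>n. Lp_norm \<infinity> Y (\<lambda>y. h y - hs n y)) \<longlonglongrightarrow> 0"
      and hsU: "\<forall>n. (\<lambda>y. u y + \<tau> n * hs n y) \<in> U"
    define e where "e n = enn2real (Lp_norm \<infinity> Y (\<lambda>y. h y - hs n y))" for n
    define b where "b n = 1 - \<tau> n * (e n / c)" for n
    have e0: "e n \<ge> 0" for n
      by (simp add: e_def)
    have e_lim: "(\<lambda>n. e n / c) \<longlonglongrightarrow> 0"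
    proof -
      have "e \<longlonglongrightarrow> 0"
        unfolding e_def using tendsto_enn2real[of _ 0 sequentially] hs by simp
      then show ?thesis
        by (auto intro: tendsto_divide_zero)
    qed
    have b_lim: "b \<longlonglongrightarrow> 1"
      unfolding b_def using tendsto_diff[OF tendsto_const tendsto_mult[OF \<tau>(2) e_lim]] by simp
    have \<sigma>_lim: "(\<lambda>n. \<tau> n / b n) \<longlonglongrightarrow> 0"
      using tendsto_divide[OF \<tau>(2) b_lim] by simp
    have "\<forall>\<^sub>F n in sequentially. Lp_norm \<infinity> Y (\<lambda>y. h y - hs n y) < \<infinity> \<and> e n / c < 1 \<and>
        0 < b n \<and> \<tau> n / b n < T"
      using order_tendstoD(2)[OF hs, of \<infinity>] order_tendstoD(2)[OF e_lim, of 1]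
        order_tendstoD(1)[OF b_lim, of 0] order_tendstoD(2)[OF \<sigma>_lim T(1)]
      by (auto intro!: eventually_conj)
    \<comment> \<open>The bounds hold from some index \<open>N\<close> on, so limits are taken of the shifted sequences.\<close>
    then obtain N where N: "\<And>n. n \<ge> N \<Longrightarrow> Lp_norm \<infinity> Y (\<lambda>y. h y - hs n y) < \<infinity>"
        "\<And>n. n \<ge> N \<Longrightarrow> e n / c < 1" "\<And>n. n \<ge> N \<Longrightarrow> 0 < b n" "\<And>n. n \<ge> N \<Longrightarrow> \<tau> n / b n < T"
      by (auto simp: eventually_sequentially)
    define R where "R n x = (F (\<lambda>y. u y + \<tau> n * hs n y) x - F u x) / \<tau> n - d x" for n x
    have R_meas [measurable]: "R n \<in> borel_measurable X" for n
      unfolding R_def using F_measurable[OF hsU[rule_format, of n]] by measurable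
    have \<sigma>_pos: "0 < \<tau> n / b n" if "n \<ge> N" for n
      using \<tau>(1) N(3)[OF that] by simp
    have bound: "AE x in X. \<bar>R n x\<bar> \<le> e n / c * \<bar>F u x\<bar> + (d x - diff_quotient u h (\<tau> n / b n) x)"
      if n: "n \<ge> N" for n
    proof -
      define a where "a = 1 + \<tau> n * (e n / c)"
      have pos: "\<tau> n * (e n / c) \<ge> 0"
        using \<tau>(1) e0 c(1) by (simp add: less_imp_le)
      then have a: "a \<ge> 1" and bn: "b n \<le> 1"
        by (simp_all add: a_def b_def)
      have "\<tau> n / a \<le> \<tau> n / b n"
        using a bn N(3)[OF n] \<tau>(1) by (intro divide_left_mono) (auto simp: less_imp_le)
      then have \<sigma>': "0 < \<tau> n / a" "\<tau> n / a \<le> T"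
        using a \<tau>(1) N(4)[OF n] by auto
      have \<sigma>: "0 < \<tau> n / b n" "\<tau> n / b n \<le> T"
        using \<sigma>_pos[OF n] N(4)[OF n] by auto
      have dist: "AE y in Y. \<bar>h y - hs n y\<bar> \<le> e n"
        using AE_abs_le_esssup[of "\<lambda>y. h y - hs n y" Y] N(1)[OF n] e0[of n]
        by (simp add: e_def flip: ennreal_le_iff)
      have "AE x in X. diff_quotient u (hs n) (\<tau> n) x \<le> diff_quotient u h (\<tau> n / a) x + e n / c * F u x"
        unfolding a_def
      proof (rule diff_quotient_upper[OF u c _ e0])
        show "AE y in Y. hs n y \<le> h y + e n"
          using dist by eventually_elim auto
      qed (use \<tau>(1) hsU seg[OF \<sigma>'] in \<open>auto simp: a_def\<close>)
      moreover have "AE x in X. diff_quotient u h (\<tau> n / b n) x - e n / c * F u x \<le>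
          diff_quotient u (hs n) (\<tau> n) x"
        unfolding b_def
      proof (rule diff_quotient_lower[OF u c _ e0])
        show "AE y in Y. h y - e n \<le> hs n y"
          using dist by eventually_elim auto
        show "\<tau> n * (e n / c) < 1"
          using N(3)[OF n] by (simp add: b_def)
      qed (use \<tau>(1) hsU seg[OF \<sigma>] in \<open>auto simp: b_def\<close>)
      ultimately show ?thesis
        using d_upper[OF \<sigma>'] d_upper[OF \<sigma>]
      proof eventually_elim
        case (elim x)
        have "e n / c * F u x \<le> e n / c * \<bar>F u x\<bar>" "e n / c * - F u x \<le> e n / c * \<bar>F u x\<bar>"
          using e0[of n] c(1) by (intro mult_left_mono; simp)+
        moreover have "R n x = diff_quotient u (hs n) (\<tau> n) x - d x"
          by (simp add: R_def diff_quotient_def)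
        ultimately show ?case
          using elim by (simp add: abs_le_iff)
      qed
    qed
    have R_le: "AE x in X. \<bar>R n x\<bar> \<le> \<bar>G x\<bar>" if n: "n \<ge> N" for n
    proof -
      have "AE x in X. diff_quotient u h T x \<le> diff_quotient u h (\<tau> n / b n) x"
        using \<sigma>_pos[OF n] N(4)[OF n] by (intro diff_quotient_antimono u T) auto
      then show ?thesis
        using bound[OF n]
      proof eventually_elim
        case (elim x)
        have "e n / c * \<bar>F u x\<bar> \<le> 1 * \<bar>F u x\<bar>"
          using N(2)[OF n] by (intro mult_right_mono) auto
        then show ?case
          using elim by (simp add: G_def)
      qed
    qed
    \<comment> \<open>The steps \<open>\<tau> n / b n\<close> depend on \<open>n\<close>, while the limit defining \<open>d\<close> runs over \<open>T / (k + 1)\<close>;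
        monotonicity links the two once \<open>\<tau> n / b n\<close> has dropped below \<open>T / (k + 1)\<close>.\<close>
    have R_lim: "AE x in X. (\<lambda>n. R (n + N) x) \<longlonglongrightarrow> 0"
    proof -
      have "AE x in X. \<forall>n\<ge>N. \<bar>R n x\<bar> \<le>
          e n / c * \<bar>F u x\<bar> + (d x - diff_quotient u h (\<tau> n / b n) x)"
        using bound by (auto simp: AE_all_countable)
      moreover have "AE x in X. \<forall>n k. N \<le> n \<and> \<tau> n / b n \<le> T / real (Suc k) \<longrightarrow>
          diff_quotient u h (T / real (Suc k)) x \<le> diff_quotient u h (\<tau> n / b n) x"
        unfolding AE_all_countable
      proof (intro allI)
        fix n k
        have "(\<lambda>y. u y + T / real (Suc k) * h y) \<in> U"
          using T(1) by (intro seg) (auto simp: field_simps)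
        then have "AE x in X. diff_quotient u h (T / real (Suc k)) x \<le> diff_quotient u h (\<tau> n / b n) x"
          if "N \<le> n" "\<tau> n / b n \<le> T / real (Suc k)"
          using that \<sigma>_pos by (intro diff_quotient_antimono u) auto
        then show "AE x in X. N \<le> n \<and> \<tau> n / b n \<le> T / real (Suc k) \<longrightarrow>
            diff_quotient u h (T / real (Suc k)) x \<le> diff_quotient u h (\<tau> n / b n) x"
          by (cases "N \<le> n \<and> \<tau> n / b n \<le> T / real (Suc k)") auto
      qed
      ultimately show ?thesis
        using d_lim
      proof eventually_elim
        case (elim x)
        note R_bound = elim(1) and monotone = elim(2)
        have "(\<lambda>n. R n x) \<longlonglongrightarrow> 0"
        proof (rule LIMSEQ_I)
          fix \<epsilon> :: real assume \<epsilon>: "\<epsilon> > 0"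
          have "\<forall>\<^sub>F k in sequentially. d x - \<epsilon> / 2 < diff_quotient u h (T / real (Suc k)) x"
            using \<epsilon> by (intro order_tendstoD(1)[OF elim(3)]) auto
          then obtain k where k: "d x - \<epsilon> / 2 < diff_quotient u h (T / real (Suc k)) x"
            by (meson eventually_sequentially order_refl)
          have "(\<lambda>n. e n / c * \<bar>F u x\<bar>) \<longlonglongrightarrow> 0"
            using tendsto_mult[OF e_lim tendsto_const] by simp
          then have "\<forall>\<^sub>F n in sequentially. e n / c * \<bar>F u x\<bar> < \<epsilon> / 2"
            using \<epsilon> by (intro order_tendstoD(2)) auto
          moreover have "\<forall>\<^sub>F n in sequentially. \<tau> n / b n < T / real (Suc k)"
            using T(1) by (intro order_tendstoD(2)[OF \<sigma>_lim]) auto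
          moreover have "\<forall>\<^sub>F n in sequentially. n \<ge> N"
            by (rule eventually_ge_at_top)
          ultimately have "\<forall>\<^sub>F n in sequentially. norm (R n x - 0) < \<epsilon>"
          proof eventually_elim
            case (elim n)
            have "\<bar>R n x\<bar> \<le> e n / c * \<bar>F u x\<bar> + (d x - diff_quotient u h (\<tau> n / b n) x)"
              using R_bound elim(3) by blast
            moreover have "diff_quotient u h (T / real (Suc k)) x \<le> diff_quotient u h (\<tau> n / b n) x"
              using monotone elim(2,3) less_imp_le by blast
            ultimately show ?case
              unfolding real_norm_def diff_zero using elim(1) k by linarith
          qed
          then show "\<exists>no. \<forall>n\<ge>no. norm (R n x - 0) < \<epsilon>"
            by (simp add: eventually_sequentially)
        qed
        then show ?case
          by (rule LIMSEQ_ignore_initial_segment)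
      qed
    qed
    have "(\<lambda>n. Lp_norm q X (R n)) \<longlonglongrightarrow> 0" if q: "r \<le> q" "q \<le> s" "q \<noteq> \<infinity>" for q
    proof (rule LIMSEQ_offset[of _ N], rule Lp_norm_dominated_convergence[OF _ q(3)])
      have "(0::ennreal) < 1"
        by simp
      then show "0 < q"
        using exponents(1) q(1) by (meson less_le_trans)
      show "G \<in> Lp q X"
        using G q by (intro Lp_interpolation[of G r X s q]) auto
    qed (use R_lim R_le in auto)
    moreover have "(\<lambda>n. \<integral>x. z x * R n x \<partial>X) \<longlonglongrightarrow> 0" if "s = \<infinity>" "z \<in> Lp 1 X" for z
    proof (rule LIMSEQ_offset[of _ N], rule integral_Linf_dominated_convergence[OF that(2)])
      show "G \<in> Lp \<infinity> X"
        using G[of s] that by simp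
    qed (use R_lim R_le in auto)
    ultimately show "let R = \<lambda>n x. (F (\<lambda>y. u y + \<tau> n * hs n y) x - F u x) / \<tau> n - d x in
        (\<forall>q. r \<le> q \<longrightarrow> q \<le> s \<longrightarrow> q \<noteq> \<infinity> \<longrightarrow> (\<lambda>n. Lp_norm q X (R n)) \<longlonglongrightarrow> 0) \<and>
        (s = \<infinity> \<longrightarrow> (\<forall>z\<in>Lp 1 X. (\<lambda>n. \<integral>x. z x * R n x \<partial>X) \<longlonglongrightarrow> 0))"
      unfolding Let_def R_def by blast
  qed
  with d show ?thesis
    by blast
qed

text \<open>
  The constant sequence of directions \<open>h\<close> is admissible, and the exponent \<open>2\<close> is finite and
  lies between \<open>r\<close> and \<open>s\<close>.
\<close>

lemma Hadamard_derivative_unique: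
  assumes u: "u \<in> U" and h: "h \<in> radial_cone U u"
    and d: "d \<in> borel_measurable X" "is_Hadamard_derivative X Y r s U F u h d"
    and e: "e \<in> borel_measurable X" "is_Hadamard_derivative X Y r s U F u h e"
  shows "AE x in X. e x = d x"
proof -
  obtain T where T: "T > 0" "(\<lambda>y. u y + T * h y) \<in> U"
    using h radial_cone_iff[OF u] by blast
  define \<tau> where "\<tau> n = T / real (Suc n)" for n
  have \<tau>: "0 < \<tau> n" "\<tau> n \<le> T" for n
    using T by (auto simp: \<tau>_def field_simps)
  have \<tau>_lim: "\<tau> \<longlonglongrightarrow> 0"
    unfolding \<tau>_def by (rule LIMSEQ_Suc[OF lim_const_over_n])
  have seg: "(\<lambda>y. u y + \<tau> n * h y) \<in> U" for n
    using segment_subset[OF u T(2)] \<tau>[of n] T by auto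
  have zero: "Lp_norm \<infinity> Y (\<lambda>y. h y - h y) = 0"
    using esssup_I[of "\<lambda>_. 0 :: ennreal" Y 0] by (simp add: Lp_norm_def)
  have "(\<lambda>n. Lp_norm 2 X (\<lambda>x. (F (\<lambda>y. u y + \<tau> n * h y) x - F u x) / \<tau> n - g x)) \<longlonglongrightarrow> 0"
    if "is_Hadamard_derivative X Y r s U F u h g" for g
    using that[unfolded is_Hadamard_derivative_def Let_def, rule_format, of \<tau> "\<lambda>_. h"]
      \<tau> \<tau>_lim h seg zero exponents by auto
  then show ?thesis
    using d e F_measurable[OF u] F_measurable[OF seg]
    by (intro Lp_2_limit_unique[where v = "\<lambda>n x. (F (\<lambda>y. u y + \<tau> n * h y) x - F u x) / \<tau> n"])
      (auto intro!: borel_measurable_divide borel_measurable_diff)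
qed

end

section \<open>The largest subsolution\<close>

context standing_assumptions
begin

text \<open>
  The maximal solution is the largest subsolution. Unlike solutions, subsolutions are stable
  under suprema, scaling and (in the concave setting) convex combinations, so inequalities
  for the maximal solution can be proved by exhibiting subsolutions.
\<close>

definition subsolution :: "'u \<Rightarrow> ('x \<Rightarrow> real) \<Rightarrow> bool" where
  "subsolution u y \<longleftrightarrow> y \<in> Lp 2 X \<and> (AE x in X. y x \<le> S (Phi y) u x)"

lemma Phi_in: "v \<in> Lp 2 X \<Longrightarrow> Phi v \<in> Pbar"
  using Phi_range by blast

lemma S_Lp: "p \<in> Pbar \<Longrightarrow> u \<in> U \<Longrightarrow> S p u \<in> Lp 2 X"
  and S_nonneg: "p \<in> Pbar \<Longrightarrow> u \<in> U \<Longrightarrow> AE x in X. 0 \<le> S p u x"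
  using S_range unfolding Lp_nonneg_def by blast+

lemma S_Phi_mono:
  assumes "u \<in> U" "v \<in> Lp 2 X" "w \<in> Lp 2 X" "AE x in X. v x \<le> w x"
  shows "AE x in X. S (Phi v) u x \<le> S (Phi w) u x"
  using assms by (intro S_mono Phi_mono Phi_in)

lemma subsolution_le_top:
  assumes "u \<in> U" "subsolution u y"
  shows "AE x in X. y x \<le> S pbar u x"
proof -
  have y: "y \<in> Lp 2 X" "AE x in X. y x \<le> S (Phi y) u x"
    using assms by (auto simp: subsolution_def)
  have "AE x in X. S (Phi y) u x \<le> S pbar u x"
    using assms(1) y greatest by (intro S_mono Phi_in) (auto intro: Phi_in)
  then show ?thesis
    using y(2) by eventually_elim simp
qed

text \<open>
  Suprema of countable families of subsolutions are subsolutions, because each member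
  satisfies \<open>f i \<le> S (Phi (f i)) u \<le> S (Phi y) u\<close> when \<open>y\<close> is the supremum. The supremum is
  described almost everywhere through its order property, so that the same lemma serves
  maxima of two functions and suprema of sequences.
\<close>

lemma subsolution_Sup:
  assumes u: "u \<in> U" and y: "y \<in> borel_measurable X" "AE x in X. 0 \<le> y x"
    and sub: "\<And>i::nat. subsolution u (f i)"
    and below: "\<And>i. AE x in X. f i x \<le> y x"
    and sup: "AE x in X. \<forall>b. (\<forall>i. f i x \<le> b) \<longrightarrow> y x \<le> b"
  shows "subsolution u y"
proof -
  have f: "f i \<in> Lp 2 X" "AE x in X. f i x \<le> S (Phi (f i)) u x" for i
    using sub[of i] by (auto simp: subsolution_def)
  have "AE x in X. \<forall>i. f i x \<le> S pbar u x"
    using subsolution_le_top[OF u sub] by (simp add: AE_all_countable)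
  then have "AE x in X. y x \<le> S pbar u x"
    using sup by eventually_elim blast
  then have "AE x in X. \<bar>y x\<bar> \<le> 1 * (\<bar>S pbar u x\<bar> + \<bar>S pbar u x\<bar>)"
    using y(2) by eventually_elim auto
  then have y_Lp: "y \<in> Lp 2 X"
    using Lp_dominated[OF S_Lp[OF greatest(1) u] S_Lp[OF greatest(1) u] y(1), of 1] by simp
  have "AE x in X. f i x \<le> S (Phi y) u x" for i
    using f(2)[of i] S_Phi_mono[OF u f(1)[of i] y_Lp below[of i]] by eventually_elim simp
  then have "AE x in X. \<forall>i. f i x \<le> S (Phi y) u x"
    by (simp add: AE_all_countable)
  then have "AE x in X. y x \<le> S (Phi y) u x"
    using sup by eventually_elim blast
  with y_Lp show ?thesis
    by (simp add: subsolution_def)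
qed

lemma subsolution_max:
  assumes u: "u \<in> U" and f: "subsolution u f" and g: "subsolution u g" "AE x in X. 0 \<le> g x"
  shows "subsolution u (\<lambda>x. max (f x) (g x))"
proof (rule subsolution_Sup[OF u, where f = "\<lambda>i. if i = 0 then f else g"])
  have [measurable]: "f \<in> borel_measurable X" "g \<in> borel_measurable X"
    using f g by (auto simp: subsolution_def intro: Lp_measurable)
  show "(\<lambda>x. max (f x) (g x)) \<in> borel_measurable X"
    by measurable
  show "AE x in X. \<forall>b. (\<forall>i::nat. (if i = 0 then f else g) x \<le> b) \<longrightarrow> max (f x) (g x) \<le> b"
  proof (rule AE_I2, intro allI impI)
    fix x b assume "x \<in> space X" and le: "\<forall>i::nat. (if i = 0 then f else g) x \<le> b"
    from le[THEN spec, of 0] le[THEN spec, of 1] show "max (f x) (g x) \<le> b"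
      by simp
  qed
qed (use f g in auto)

lemma subsolution_zero: "u \<in> U \<Longrightarrow> subsolution u (\<lambda>x. 0)"
proof -
  assume u: "u \<in> U"
  have "(\<lambda>x. 0) \<in> Lp 2 X"
    using Lp_linear_combination[OF S_Lp[OF greatest(1) u] S_Lp[OF greatest(1) u], of 0 0] by simp
  then show ?thesis
    using S_nonneg[OF Phi_in u] by (simp add: subsolution_def)
qed

lemma nn_integral_square_finite:
  assumes "f \<in> Lp 2 X"
  shows "(\<integral>\<^sup>+ x. ennreal ((f x)\<^sup>2) \<partial>X) < \<infinity>"
  using assms by (simp add: Lp_finite_iff)

text \<open>
  An exhaustion argument, in which square integrals stand in for the measure so that infinite
  measures cause no trouble. Take the supremum of a sequence of nonnegative subsolutions
  whose square integrals approach the least upper bound. For any further subsolution \<open>v\<close>, the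
  maximum of \<open>v\<close> and that supremum \<open>g\<close> is again admissible but cannot increase the square
  integral, which is finite; hence it equals \<open>g\<close> almost everywhere.
\<close>

theorem ex_largest_subsolution:
  assumes u: "u \<in> U"
  shows "\<exists>g. subsolution u g \<and> (\<forall>f. subsolution u f \<longrightarrow> (AE x in X. f x \<le> g x))"
proof -
  define B where "B = {f. subsolution u f \<and> (AE x in X. 0 \<le> f x)}"
  define I where "I f = (\<integral>\<^sup>+ x. ennreal ((f x)\<^sup>2) \<partial>X)" for f :: "'x \<Rightarrow> real"
  have B_meas: "f \<in> borel_measurable X" if "f \<in> B" for f
    using that by (auto simp: B_def subsolution_def intro: Lp_measurable)
  have I_mono: "I f \<le> I g" if "f \<in> B" "AE x in X. f x \<le> g x" for f g
  proof -
    have "AE x in X. 0 \<le> f x"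
      using that by (simp add: B_def)
    then have "AE x in X. ennreal ((f x)\<^sup>2) \<le> ennreal ((g x)\<^sup>2)"
      using that(2) by eventually_elim (auto intro!: ennreal_leI power_mono)
    then show ?thesis
      unfolding I_def by (rule nn_integral_mono_AE)
  qed
  have "B \<noteq> {}"
    using subsolution_zero[OF u] by (auto simp: B_def)
  then obtain a :: "nat \<Rightarrow> ennreal" where a: "range a \<subseteq> I ` B" "Sup (I ` B) = Sup (range a)"
    using ennreal_SUP_countable_SUP[of B I] by blast
  then have "\<exists>f. f \<in> B \<and> I f = a n" for n
    by (metis imageE range_subsetD)
  then obtain f where f: "\<And>n. f n \<in> B" "\<And>n. I (f n) = a n"
    by metis
  have sub: "subsolution u (f n)" and f_nonneg: "AE x in X. 0 \<le> f n x" for n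
    using f(1)[of n] by (auto simp: B_def)
  \<comment> \<open>Truncation by \<open>S pbar u\<close> changes \<open>f n\<close> on a null set only, and makes the real supremum exist
    at every point.\<close>
  define k where "k n x = min (f n x) (S pbar u x)" for n x
  define g where "g x = (SUP n. k n x)" for x
  have bdd: "bdd_above (range (\<lambda>n. k n x))" for x
    by (rule bdd_aboveI[of _ "S pbar u x"]) (auto simp: k_def)
  have [measurable]: "f n \<in> borel_measurable X" "S pbar u \<in> borel_measurable X" for n
    using B_meas[OF f(1)] S_Lp[OF greatest(1) u] by (auto intro: Lp_measurable)
  have g_meas [measurable]: "g \<in> borel_measurable X"
    unfolding g_def using bdd by (intro borel_measurable_cSUP) (auto simp: k_def[abs_def])
  have "AE x in X. \<forall>n. k n x = f n x"
    unfolding AE_all_countable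
  proof
    show "AE x in X. k n x = f n x" for n
      using subsolution_le_top[OF u sub[of n]] by eventually_elim (simp add: k_def)
  qed
  then have g_sup: "AE x in X. (\<forall>n. f n x \<le> g x) \<and> (\<forall>b. (\<forall>n. f n x \<le> b) \<longrightarrow> g x \<le> b)"
  proof eventually_elim
    case (elim x)
    have "k n x \<le> g x" for n
      unfolding g_def by (rule cSUP_upper[OF UNIV_I bdd])
    moreover have "g x \<le> b" if "\<forall>n. k n x \<le> b" for b
      unfolding g_def using that by (intro cSUP_least) auto
    ultimately show ?case
      using elim by simp
  qed
  then have fg: "AE x in X. f n x \<le> g x" for n
    by eventually_elim blast
  have g_nonneg: "AE x in X. 0 \<le> g x"
    using fg[of 0] f_nonneg[of 0] by eventually_elim simp
  have g_sub: "subsolution u g"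
  proof (rule subsolution_Sup[OF u g_meas g_nonneg sub fg])
    show "AE x in X. \<forall>b. (\<forall>n. f n x \<le> b) \<longrightarrow> g x \<le> b"
      using g_sup by eventually_elim blast
  qed
  have I_le: "I v \<le> I g" if "v \<in> B" for v
  proof -
    have "I v \<le> Sup (range a)"
      using that unfolding a(2)[symmetric] by (intro Sup_upper) auto
    also have "\<dots> \<le> I g"
      using I_mono[OF f(1) fg] f(2) by (auto intro: Sup_least)
    finally show ?thesis .
  qed
  have "AE x in X. v x \<le> g x" if v: "subsolution u v" for v
  proof -
    define m where "m x = max (v x) (g x)" for x
    have m_sub: "subsolution u m"
      unfolding m_def using subsolution_max[OF u v g_sub g_nonneg] .
    have "m \<in> B"
      using m_sub g_nonneg by (auto simp: B_def m_def le_max_iff_disj elim: eventually_mono)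
    have [measurable]: "m \<in> borel_measurable X"
      using B_meas[OF \<open>m \<in> B\<close>] .
    have fin: "I g < \<infinity>"
      using g_sub unfolding I_def subsolution_def by (intro nn_integral_square_finite) auto
    have "(\<integral>\<^sup>+ x. ennreal ((m x)\<^sup>2) - ennreal ((g x)\<^sup>2) \<partial>X) = I m - I g"
      unfolding I_def
    proof (rule nn_integral_diff)
      show "AE x in X. ennreal ((g x)\<^sup>2) \<le> ennreal ((m x)\<^sup>2)"
        using g_nonneg by eventually_elim (auto simp: m_def intro!: ennreal_leI power_mono)
    qed (use fin in \<open>auto simp: I_def\<close>)
    also have "\<dots> = 0"
      using I_le[OF \<open>m \<in> B\<close>] le_less_trans[OF I_le[OF \<open>m \<in> B\<close>] fin]
      by (simp add: diff_eq_0_iff_ennreal)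
    finally have "AE x in X. ennreal ((m x)\<^sup>2) - ennreal ((g x)\<^sup>2) = 0"
      by (subst (asm) nn_integral_0_iff_AE) auto
    then show ?thesis
      using g_nonneg
    proof eventually_elim
      case (elim x)
      then have "(m x)\<^sup>2 \<le> (g x)\<^sup>2"
        by (simp add: diff_eq_0_iff_ennreal)
      then have "m x \<le> g x"
        using elim(2) by (rule power2_le_imp_le)
      then show ?case
        by (simp add: m_def)
    qed
  qed
  with g_sub show ?thesis
    by blast
qed

text \<open>
  For the largest subsolution \<open>g\<close>, monotonicity makes \<open>S (Phi g) u\<close> a subsolution too, which
  forces \<open>g = S (Phi g) u\<close>.
\<close>

lemma maximal_solution_largest_subsolution:
  assumes u: "u \<in> U"
  shows "is_solution X S Phi u (maximal_solution X S Phi u)"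
    and "\<And>f. subsolution u f \<Longrightarrow> AE x in X. f x \<le> maximal_solution X S Phi u x"
proof -
  obtain g where g: "subsolution u g" and g_max: "\<And>f. subsolution u f \<Longrightarrow> AE x in X. f x \<le> g x"
    using ex_largest_subsolution[OF u] by blast
  have g_Lp: "g \<in> Lp 2 X" and g_le: "AE x in X. g x \<le> S (Phi g) u x"
    using g by (auto simp: subsolution_def)
  have Sg: "S (Phi g) u \<in> Lp 2 X"
    by (intro S_Lp Phi_in g_Lp u)
  have "subsolution u (S (Phi g) u)"
    using S_Phi_mono[OF u g_Lp Sg g_le] Sg by (simp add: subsolution_def)
  then have "AE x in X. S (Phi g) u x \<le> g x"
    by (rule g_max)
  then have sol: "is_solution X S Phi u g"
    using g_le g_Lp unfolding is_solution_def by (auto elim!: eventually_elim2)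
  have sub: "subsolution u w" if "is_solution X S Phi u w" for w
    using that unfolding is_solution_def subsolution_def by (auto elim: eventually_mono)
  have "is_maximal_solution X S Phi u g"
    unfolding is_maximal_solution_def using sol g_max sub by blast
  then have max: "is_maximal_solution X S Phi u (maximal_solution X S Phi u)"
    unfolding maximal_solution_def by (rule someI[of "is_maximal_solution X S Phi u"])
  then show "is_solution X S Phi u (maximal_solution X S Phi u)"
    by (simp add: is_maximal_solution_def)
  fix f assume "subsolution u f"
  then have "AE x in X. f x \<le> g x"
    by (rule g_max)
  moreover have "AE x in X. g x \<le> maximal_solution X S Phi u x"
    using max sol by (simp add: is_maximal_solution_def)
  ultimately show "AE x in X. f x \<le> maximal_solution X S Phi u x"
    by eventually_elim simp
qed

lemma maximal_solution_eq:
  assumes "u \<in> U"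
  shows "maximal_solution X S Phi u \<in> Lp 2 X"
    and "AE x in X. maximal_solution X S Phi u x = S (Phi (maximal_solution X S Phi u)) u x"
  using maximal_solution_largest_subsolution(1)[OF assms] by (auto simp: is_solution_def)

lemma maximal_solution_nonneg:
  assumes "u \<in> U"
  shows "maximal_solution X S Phi u \<in> Lp_nonneg 2 X"
  using maximal_solution_eq[OF assms] S_nonneg[OF Phi_in assms]
  unfolding Lp_nonneg_def by (fastforce elim: eventually_elim2)

end

section \<open>Differentiability of the maximal solution map\<close>

theorem corollary4p4:
  fixes X :: "'x measure" and Y :: "'y measure"
    and P :: "'v::real_vector set"
    and le :: "'v option \<Rightarrow> 'v option \<Rightarrow> bool"
    and U :: "('y \<Rightarrow> real) set"
    and S :: "'v option \<Rightarrow> ('y \<Rightarrow> real) \<Rightarrow> 'x \<Rightarrow> real"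
    and \<Phi> :: "('x \<Rightarrow> real) \<Rightarrow> 'v"
    and M :: "('y \<Rightarrow> real) \<Rightarrow> 'x \<Rightarrow> real"
    and r s :: ennreal
  \<comment> \<open>Pbar is P with the formal largest element None adjoined, so that pbar is not
      required to be a vector.\<close>
  defines "M \<equiv> maximal_solution X S (\<lambda>v. Some (\<Phi> v))"
  assumes standing:
      "standing_assumptions X (insert None (Some ` P)) le None U S (\<lambda>v. Some (\<Phi> v))"
    and P_convex: "convex P"
    and P_scale: "\<And>p t. p \<in> P \<Longrightarrow> t \<in> {0<..1} \<Longrightarrow> t *\<^sub>R p \<in> P"
    and Y_complete: "complete_measure Y"
    and U_subset: "U \<subseteq> Lp_nonneg \<infinity> Y"
    and U_classes: "AE_closed Y U"
    and U_convex: "fun_convex U"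
    and U_scale: "\<And>u t. u \<in> U \<Longrightarrow> t \<in> {0<..1} \<Longrightarrow> (\<lambda>y. t * u y) \<in> U"
    and S_well_defined: "\<And>p u1 u2. p \<in> insert None (Some ` P) \<Longrightarrow> u1 \<in> U \<Longrightarrow> u2 \<in> U \<Longrightarrow>
      (AE y in Y. u1 y = u2 y) \<Longrightarrow> (AE x in X. S p u1 x = S p u2 x)"
    and S_scale: "\<And>p u t. p \<in> P \<Longrightarrow> u \<in> U \<Longrightarrow> t \<in> {0<..1} \<Longrightarrow>
      (AE x in X. t * S (Some p) u x \<le> S (Some (t *\<^sub>R p)) (\<lambda>y. t * u y) x)"
    and S_mono: "\<And>p u1 u2. p \<in> P \<Longrightarrow> u1 \<in> U \<Longrightarrow> u2 \<in> U \<Longrightarrow>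
      (AE y in Y. u1 y \<le> u2 y) \<Longrightarrow> (AE x in X. S (Some p) u1 x \<le> S (Some p) u2 x)"
    and S_concave: "\<And>p1 p2 u1 u2 t. p1 \<in> P \<Longrightarrow> p2 \<in> P \<Longrightarrow> u1 \<in> U \<Longrightarrow> u2 \<in> U \<Longrightarrow> t \<in> {0..1} \<Longrightarrow>
      (AE x in X. t * S (Some p1) u1 x + (1 - t) * S (Some p2) u2 x
        \<le> S (Some (t *\<^sub>R p1 + (1 - t) *\<^sub>R p2)) (\<lambda>y. t * u1 y + (1 - t) * u2 y) x)"
    and \<Phi>_scale: "\<And>v t. v \<in> Lp_nonneg 2 X \<Longrightarrow> t \<in> {0<..1} \<Longrightarrow>
      le (Some (t *\<^sub>R \<Phi> v)) (Some (\<Phi> (\<lambda>x. t * v x)))"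
    and \<Phi>_concave: "\<And>v1 v2 t. v1 \<in> Lp_nonneg 2 X \<Longrightarrow> v2 \<in> Lp_nonneg 2 X \<Longrightarrow> t \<in> {0..1} \<Longrightarrow>
      le (Some (t *\<^sub>R \<Phi> v1 + (1 - t) *\<^sub>R \<Phi> v2)) (Some (\<Phi> (\<lambda>x. t * v1 x + (1 - t) * v2 x)))"
    and exponents: "1 \<le> r" "r \<le> 2" "2 \<le> s"
    and S_regular: "\<And>p u. p \<in> P \<Longrightarrow> u \<in> U \<Longrightarrow> S (Some p) u \<in> Lp_between r s X"
  shows "\<forall>u \<in> U \<inter> Linf_pos Y. \<forall>h \<in> radial_cone U u.
    \<exists>d \<in> Lp_between r s X. is_Hadamard_derivative X Y r s U M u h d \<and>
      (\<forall>e \<in> Lp_between r s X. is_Hadamard_derivative X Y r s U M u h e \<longrightarrow>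
        (AE x in X. e x = d x))"
proof -
  note S_control_mono = S_mono
  interpret standing_assumptions X "insert None (Some ` P)" le None U S "\<lambda>v. Some (\<Phi> v)"
    by (rule standing)
  have \<Phi>_P: "\<Phi> v \<in> P" if "v \<in> Lp 2 X" for v
    using Phi_range[OF that] by auto
  have M_Lp: "M u \<in> Lp_nonneg 2 X" "M u \<in> Lp 2 X" if "u \<in> U" for u
    using maximal_solution_nonneg[OF that] maximal_solution_eq[OF that] by (simp_all add: M_def)
  have M_eq: "AE x in X. M u x = S (Some (\<Phi> (M u))) u x" if "u \<in> U" for u
    using maximal_solution_eq(2)[OF that] by (simp add: M_def)
  have M_largest: "AE x in X. f x \<le> M u x"
    if "u \<in> U" "f \<in> Lp 2 X" "AE x in X. f x \<le> S (Some (\<Phi> f)) u x" for u f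
    using maximal_solution_largest_subsolution(2)[OF that(1), of f] that
    by (simp add: M_def subsolution_def)
  have S_le: "AE x in X. S (Some p) u x \<le> S (Some q) u x"
    if "p \<in> P" "q \<in> P" "u \<in> U" "le (Some p) (Some q)" for p q u
    using that by (intro standing_assumptions.S_mono[OF standing]) auto
  \<comment> \<open>Scaled and convexly combined solutions are subsolutions for the scaled and combined
    parameters, hence lie below the maximal solutions there.\<close>
  interpret concave_superhomogeneous_map X Y r s U M
  proof
    show "U \<subseteq> Lp \<infinity> Y"
      using U_subset by (auto simp: Lp_nonneg_def)
    show "fun_convex U"
      by (rule U_convex)
    show "(\<lambda>y. t * u y) \<in> U" if "u \<in> U" "t \<in> {0<..1}" for u t
      using that by (rule U_scale)
    show "M u \<in> Lp_between r s X" if u: "u \<in> U" for u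
    proof -
      have "S (Some (\<Phi> (M u))) u \<in> Lp_between r s X"
        by (intro S_regular \<Phi>_P M_Lp u)
      moreover have "AE x in X. S (Some (\<Phi> (M u))) u x = M u x"
        using M_eq[OF u] by eventually_elim simp
      ultimately show ?thesis
        using M_Lp(2)[OF u, THEN Lp_measurable] by (auto simp: Lp_between_def intro: Lp_cong_AE)
    qed
    show "AE x in X. M u1 x \<le> M u2 x"
      if u: "u1 \<in> U" "u2 \<in> U" and le: "AE y in Y. u1 y \<le> u2 y" for u1 u2
    proof (rule M_largest[OF u(2) M_Lp(2)[OF u(1)]])
      show "AE x in X. M u1 x \<le> S (Some (\<Phi> (M u1))) u2 x"
        using M_eq[OF u(1)] S_control_mono[OF \<Phi>_P[OF M_Lp(2)[OF u(1)]] u le] by eventually_elim simp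
    qed
    show "AE x in X. t * M u x \<le> M (\<lambda>y. t * u y) x" if u: "u \<in> U" and t: "t \<in> {0<..1}" for u t
    proof (rule M_largest[OF U_scale[OF u t]])
      show tM: "(\<lambda>x. t * M u x) \<in> Lp 2 X"
        using Lp_linear_combination[OF M_Lp(2)[OF u] M_Lp(2)[OF u], of t 0] by simp
      have p: "\<Phi> (M u) \<in> P"
        by (intro \<Phi>_P M_Lp u)
      have "AE x in X. S (Some (t *\<^sub>R \<Phi> (M u))) (\<lambda>y. t * u y) x \<le>
          S (Some (\<Phi> (\<lambda>x. t * M u x))) (\<lambda>y. t * u y) x"
        by (intro S_le P_scale p \<Phi>_P tM U_scale u t \<Phi>_scale M_Lp)
      then show "AE x in X. t * M u x \<le> S (Some (\<Phi> (\<lambda>x. t * M u x))) (\<lambda>y. t * u y) x"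
        using M_eq[OF u] S_scale[OF p u t] by eventually_elim simp
    qed
    show "AE x in X. t * M u1 x + (1 - t) * M u2 x \<le> M (\<lambda>y. t * u1 y + (1 - t) * u2 y) x"
      if u: "u1 \<in> U" "u2 \<in> U" and t: "t \<in> {0..1}" for u1 u2 t
    proof (rule M_largest)
      show v: "(\<lambda>x. t * M u1 x + (1 - t) * M u2 x) \<in> Lp 2 X"
        by (intro Lp_linear_combination M_Lp u)
      show w: "(\<lambda>y. t * u1 y + (1 - t) * u2 y) \<in> U"
        using U_convex u t unfolding fun_convex_def by blast
      have p: "\<Phi> (M u1) \<in> P" "\<Phi> (M u2) \<in> P"
        by (intro \<Phi>_P M_Lp u)+
      have "t *\<^sub>R \<Phi> (M u1) + (1 - t) *\<^sub>R \<Phi> (M u2) \<in> P"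
        using P_convex p t by (intro convexD) auto
      then have "AE x in X.
          S (Some (t *\<^sub>R \<Phi> (M u1) + (1 - t) *\<^sub>R \<Phi> (M u2))) (\<lambda>y. t * u1 y + (1 - t) * u2 y) x \<le>
          S (Some (\<Phi> (\<lambda>x. t * M u1 x + (1 - t) * M u2 x))) (\<lambda>y. t * u1 y + (1 - t) * u2 y) x"
        by (intro S_le \<Phi>_P v w \<Phi>_concave M_Lp u t)
      then show "AE x in X. t * M u1 x + (1 - t) * M u2 x \<le>
          S (Some (\<Phi> (\<lambda>x. t * M u1 x + (1 - t) * M u2 x))) (\<lambda>y. t * u1 y + (1 - t) * u2 y) x"
        using M_eq[OF u(1)] M_eq[OF u(2)] S_concave[OF p u t] by eventually_elim simp
    qed
  qed (use exponents in auto)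
  show ?thesis
  proof (intro ballI)
    fix u h assume "u \<in> U \<inter> Linf_pos Y" and h: "h \<in> radial_cone U u"
    then obtain c where u: "u \<in> U" and c: "c > 0" "AE y in Y. c \<le> u y"
      by (auto simp: Linf_pos_def)
    obtain d where d: "d \<in> Lp_between r s X" "is_Hadamard_derivative X Y r s U M u h d"
      using Hadamard_differentiable[OF u c h] by blast
    have "AE x in X. e x = d x"
      if "e \<in> Lp_between r s X" "is_Hadamard_derivative X Y r s U M u h e" for e
      using that d by (intro Hadamard_derivative_unique[OF u h])
        (auto simp: Lp_between_def intro: Lp_measurable)
    with d show "\<exists>d \<in> Lp_between r s X. is_Hadamard_derivative X Y r s U M u h d \<and>
        (\<forall>e \<in> Lp_between r s X. is_Hadamard_derivative X Y r s U M u h e \<longrightarrow>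
          (AE x in X. e x = d x))"
      by blast
  qed
qed

end
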